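(* Let $n\ge 1$ be an integer and suppose that $S=\sum_{i=1}^n X_i$ is a sum of independent real-valued random variables with $\mathbb{P}(0\le X_i\le 1)=1$ for $1\le i\le n$ and $\mathbb{E}S=\lambda$. Then $$\mathbb{P}(S\le 1)\le \max\left\{\left(1+\lambda-\frac{\lambda}{n}\right)\left(1-\frac{\lambda}{n}\right)^{n-1},\ \left(1-\frac{\lambda-1}{n-1}\right)^{n-1}\right\}\le \max\{1+\lambda,\,e\}\,e^{-\lambda}.$$
   Context: Convention for $n=1$: any expression raised to the power $n-1=0$ is taken to be $1$; in particular $\left(1-\frac{\lambda-1}{n-1}\right)^{n-1}$ is read as $1$ when $n=1$. *)

theory Defs
  imports "HOL-Probability.Probability"
begin

end

theory Submission
  imports Defs
begin

text \<open>Write \<open>\<lambda>\<close> for the mean of \<open>S\<close>. Two configurations compete for the maximum. All \<open>X\<^sub>i\<close> may be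
Bernoulli with mean \<open>\<lambda>/n\<close>, which gives the first term. Or one variable is pinned at \<open>1\<close>, and the
others are Bernoulli with mean \<open>(\<lambda>-1)/(n-1)\<close> and must all vanish, which gives the second.

Two reductions lead to variables \<open>b\<^sub>i \<xi>\<^sub>i\<close> with \<open>0 < b\<^sub>i \<le> 1\<close> and independent indicators \<open>\<xi>\<^sub>i\<close>.
The probability is linear in the law of each single variable, so each law may be replaced by a
two-point law with the same mean (\<open>two_point_dominates\<close>, \<open>reduction_to_two_points\<close>). If the lower
atoms add up to \<open>A\<close> and \<open>\<delta> = 1 - A\<close>, the upper atoms further than \<open>\<delta>\<close> from their lower atoms are
forbidden, and the others compete for the room \<open>\<delta>\<close>. The mean is affine in \<open>\<delta>\<close> while the probability
does not depend on it, so \<open>\<delta>\<close> can be moved to \<open>0\<close> (one variable is pinned at \<open>1\<close>) or to \<open>1\<close> (all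
lower atoms are \<open>0\<close>) without lowering the mean (\<open>two_point_bound\<close>).

For the remaining class the claim is strengthened by a parameter \<open>c \<ge> 0\<close>:
\<open>P(S \<le> 1) + c P(all \<xi>\<^sub>i = 0)\<close> is at most \<open>extremal_bound\<close>, the maximum of the pinned value and of
the value for \<open>n\<close> equal Bernoulli variables. The parameter absorbs summands with \<open>b = 1\<close>: such a
summand with probability \<open>p\<close> has the effect of the factor \<open>1 - p\<close> and of the shift
\<open>c \<mapsto> c + p/(1-p)\<close>, and the bound behaves well under this operation (\<open>extremal_bound_unit\<close>). The
proof is by induction on the number of summands (\<open>bound_holds_all\<close>). Let \<open>\<beta>\<close> be the least \<open>b\<^sub>i\<close>.
A summand with \<open>b > 1 - \<beta>\<close> cannot occur together with another one, so that raising it to \<open>1\<close> and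
lowering its probability costs nothing. Otherwise let \<open>R\<close> be the sum of the summands other than
the least one. As a function of the value of the least summand, the conditional probability at \<open>\<beta>\<close> either lies
below the chord over \<open>[0, 1]\<close>, and then \<open>\<beta>\<close> may be replaced by \<open>1\<close>, or it lies above. In the second case
everything is controlled by \<open>P(R \<le> 1 - \<beta>)\<close>, to which the induction hypothesis applies after
division by \<open>1 - \<beta>\<close> (\<open>small_step\<close>). If the mean \<open>r\<close> of \<open>R\<close> is at least \<open>1\<close>, it suffices that
\<open>\<nu> \<mapsto> \<nu> extremal_bound N 0 \<nu>\<close> decreases on \<open>[1, N]\<close>. For smaller \<open>r\<close> the chord estimate alone can fail,
since it allows \<open>R\<close> to be constant; there \<open>c\<close> may be taken to be the value for which the two
configurations tie, and the trivial bound \<open>P(R \<le> 1) \<le> 1\<close> fills the gap (\<open>window_ineq\<close>).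

The last inequality of the theorem holds because the bound increases with \<open>n\<close>, as one sees by
adding a summand that vanishes, and tends to the right-hand side (\<open>extremal_bound_le_poisson\<close>).\<close>

section \<open>Elementary inequalities\<close>

lemma amgm_power:
  fixes a d :: real
  assumes "0 \<le> a" "0 \<le> d"
  shows "a * d ^ N \<le> ((a + real N * d) / real (N+1)) ^ (N+1)"
proof (cases "d = 0")
  case True
  then show ?thesis using assms by (cases N) auto
next
  case False
  with assms have d: "d > 0" by auto
  define x where "x = (a/d - 1) / real (N+1)"
  have "real (N+1) * x = a/d - 1" by (simp add: x_def)
  then have "d * (real (N+1) * x) = d * (a/d - 1)" by simp
  then have "d * (real (N+1) * x) = a - d" using d by (simp add: right_diff_distrib)
  then have e: "(a + real N * d) / real (N+1) = d * (1 + x)"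
    by (simp add: field_simps)
  have "x \<ge> -1"
  proof -
    have "a/d \<ge> 0" using assms by simp
    then have "a/d - 1 \<ge> (-1) * real (N+1)" by simp
    then show ?thesis unfolding x_def by (subst pos_le_divide_eq) auto
  qed
  then have "1 + real (N+1) * x \<le> (1 + x) ^ (N+1)"
    by (rule Bernoulli_inequality)
  moreover have "1 + real (N+1) * x = a / d" by (simp add: x_def)
  ultimately have "d ^ (N+1) * (a/d) \<le> d ^ (N+1) * (1+x) ^ (N+1)"
    using d by (intro mult_left_mono) auto
  moreover have "d ^ (N+1) * (a/d) = a * d ^ N" using d by simp
  ultimately show ?thesis unfolding e power_mult_distrib by simp
qed

lemma bernoulli_second_order:
  fixes t :: real assumes "t \<ge> 0"
  shows "1 + real n * t + real n * (real n - 1) / 2 * t^2 \<le> (1 + t) ^ n"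
proof (induction n)
  case (Suc n)
  have "1 + real (Suc n) * t + real (Suc n) * (real (Suc n) - 1) / 2 * t^2
     \<le> (1 + t) * (1 + real n * t + real n * (real n - 1) / 2 * t^2)"
  proof -
    have "(1 + t) * (1 + real n * t + real n * (real n - 1) / 2 * t^2) - 
      (1 + real (Suc n) * t + real (Suc n) * (real (Suc n) - 1) / 2 * t^2) = real n * (real n - 1)/2 * t^3"
      by (simp add: power2_eq_square power3_eq_cube field_simps)
    moreover have "real n * (real n - 1)/2 * t^3 \<ge> 0" using assms by (cases n) auto
    ultimately show ?thesis by linarith
  qed
  also have "\<dots> \<le> (1 + t) ^ Suc n" using Suc assms by (simp add: mult_left_mono)
  finally show ?case .
qed simp

lemma power_one_minus_le:
  fixes t :: real assumes "0 \<le> t" "t \<le> 1"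
  shows "(1 - t) ^ k \<le> 1 - real k * t + (real k * t)^2 / 2"
proof (induction k)
  case (Suc k)
  have "(1 - t) ^ Suc k \<le> (1 - t) * (1 - real k * t + (real k * t)^2 / 2)"
    using Suc assms by (simp add: mult_left_mono)
  also have "\<dots> \<le> 1 - real (Suc k) * t + (real (Suc k) * t)^2 / 2"
  proof -
    have "1 - real (Suc k) * t + (real (Suc k) * t)^2 / 2 - (1 - t) * (1 - real k * t + (real k * t)^2 / 2)
       = t^2/2 + t * (real k * t)^2 / 2" by (simp add: field_simps power2_eq_square)
    moreover have "\<dots> \<ge> 0" using assms by simp
    ultimately show ?thesis by linarith
  qed
  finally show ?case .
qed simp

section \<open>The extremal bound\<close>

text \<open>The factor by which the probability that \<open>m - 1\<close> of \<open>m\<close> equal Bernoulli variables vanish grows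
when the remaining one is pinned at \<open>1\<close> and the total mean is kept. It increases to \<open>e\<close>. For \<open>m = 1\<close> it is \<open>1\<close>, because the exponent is \<open>0\<close>.\<close>
definition pinning_factor :: "nat \<Rightarrow> real"
  where "pinning_factor m = (real m / (real m - 1)) ^ (m - 1)"

text \<open>For \<open>m\<close> summands with total mean \<open>\<mu>\<close> this is the larger one of two values of
\<open>P(S \<le> 1) + c P(S = 0)\<close>: one summand pinned at \<open>1\<close> and the others equal Bernoulli variables, or
\<open>m\<close> equal Bernoulli variables.\<close>
definition extremal_bound :: "nat \<Rightarrow> real \<Rightarrow> real \<Rightarrow> real"
  where "extremal_bound m c \<mu> = (1 - \<mu> / m) ^ (m - 1) * max (pinning_factor m) ((1 + c) * (1 - \<mu> / m) + \<mu>)"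

lemma pinning_factor_1 [simp]: "pinning_factor (Suc 0) = 1" by (simp add: pinning_factor_def)

lemma pinning_factor_ge_2: assumes "m \<ge> 2" shows "pinning_factor m \<ge> 2"
proof -
  have "1 + real (m-1) * (1 / (real m - 1)) \<le> (1 + 1 / (real m - 1)) ^ (m-1)"
    using assms by (intro Bernoulli_inequality) (auto simp: field_simps)
  moreover have "1 + 1 / (real m - 1) = real m / (real m - 1)" using assms by (simp add: field_simps)
  ultimately show ?thesis using assms by (simp add: pinning_factor_def of_nat_diff)
qed

text \<open>This is \<open>ln (pinning_factor m) \<le> 1 + ln (1 - 1/(2m))\<close> in the variable \<open>u = 1/m\<close>.\<close>
lemma log_correction_bound:
  fixes u :: real
  assumes "0 \<le> u" "u < 1"
  shows "0 \<le> u + u * ln (1 - u/2) + (1-u) * ln (1-u)"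
proof -
  define f where "f = (\<lambda>u::real. u + u * ln (1 - u/2) + (1-u) * ln (1-u))"
  have "f 0 \<le> f u"
  proof (rule DERIV_nonneg_imp_nondecreasing[OF assms(1)])
    fix x assume x: "0 \<le> x" "x \<le> u"
    with assms have x1: "x < 1" by auto
    have D: "(f has_real_derivative (ln (1 - x/2) - x/(2-x) - ln (1-x))) (at x)"
      unfolding f_def
      apply (insert x x1)
      apply (rule derivative_eq_intros refl | simp)+
      done
    define t where "t = (1 - x/2) / (1 - x)"
    have t: "t > 0" using x x1 by (simp add: t_def)
    have "ln (1/t) \<le> 1/t - 1" using t by (intro ln_le_minus_one) auto
    moreover have "ln (1/t) = - (ln (1-x/2) - ln (1-x))"
      using x x1 t by (simp add: t_def ln_div)
    moreover have "1/t - 1 = - (x/(2-x))" using x x1 by (simp add: t_def field_simps)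
    ultimately have "ln (1 - x/2) - x/(2-x) - ln (1-x) \<ge> 0" by linarith
    with D show "\<exists>y. (f has_real_derivative y) (at x) \<and> 0 \<le> y" by blast
  qed
  then show ?thesis by (simp add: f_def)
qed

text \<open>The bound \<open>e (1 - 1/(2m))\<close>, with \<open>5/2 \<le> e \<le> 11/4\<close>. The correction of order \<open>1/m\<close> is essential in
\<open>critical_c_bound\<close>, where the bound \<open>e\<close> would be too weak.\<close>
lemma pinning_factor_le: assumes "m \<ge> 2" shows "pinning_factor m \<le> 11/4 - 5/(4 * real m)"
proof -
  define u where "u = 1 / real m"
  have u: "0 < u" "u < 1" using assms by (auto simp: u_def)
  have b: "real m / (real m - 1) = inverse (1 - u)" using assms by (simp add: u_def field_simps)
  have "ln (pinning_factor m) = real (m-1) * ln (inverse (1-u))"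
    unfolding pinning_factor_def b using u by (subst ln_realpow) auto
  also have "\<dots> = - ((1-u)/u * ln (1-u))"
  proof -
    have "real (m-1) = (1-u)/u" using assms by (simp add: u_def of_nat_diff field_simps)
    then show ?thesis using u by (simp add: ln_inverse)
  qed
  also have "\<dots> \<le> 1 + ln (1 - u/2)"
    using log_correction_bound[of u] u by (simp add: field_simps)
  finally have "exp (ln (pinning_factor m)) \<le> exp (1 + ln (1 - u/2))" by simp
  moreover have "pinning_factor m > 0" using pinning_factor_ge_2[OF assms] by simp
  ultimately have "pinning_factor m \<le> exp 1 * (1 - u/2)" using u by (simp add: exp_add)
  also have "\<dots> = exp 1 - exp 1 * (u/2)" by (simp add: algebra_simps)
  also have "\<dots> \<le> 11/4 - (5/2) * (u/2)"
  proof -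
    have "exp 1 \<le> (11/4::real)" using e_less_272 by simp
    moreover have "(5/2::real) \<le> exp 1" using exp_lower_Taylor_quadratic[of "1::real"] by simp
    ultimately show ?thesis using u by (intro diff_mono mult_right_mono) auto
  qed
  finally show ?thesis by (simp add: u_def)
qed

lemma pinning_factor_ge: assumes "m \<ge> 2" shows "pinning_factor m \<ge> 5/2 - 1/(2*(real m - 1))"
proof -
  have "real (m-1) = real m - 1" using assms by (simp add: of_nat_diff)
  moreover have "1 + 1 / (real m - 1) = real m / (real m - 1)" using assms by (simp add: field_simps)
  moreover have "1 + k * (1/k) + k * (k - 1) / 2 * (1/k)^2 = 5/2 - 1/(2*k)" if "k > 0" for k :: real
    using that by (simp add: field_simps power2_eq_square)
  from this[of "real m - 1"] assms have "1 + (real m - 1) * (1/(real m-1)) + (real m - 1) * (real m - 1 - 1) / 2 * (1/(real m-1))^2 = 5/2 - 1/(2*(real m - 1))"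
    by simp
  ultimately show ?thesis using bernoulli_second_order[of "1/(real m - 1)" "m-1"] assms
    by (simp add: pinning_factor_def)
qed

lemma pinning_factor_mono: assumes "2 \<le> m" "m \<le> n" shows "pinning_factor m \<le> pinning_factor n"
proof -
  have step: "pinning_factor m \<le> pinning_factor (m+1)" if "m \<ge> 2" for m
  proof -
    have "pinning_factor m = (real m / (real m - 1)) ^ (m-1)" by (simp add: pinning_factor_def)
    also have "\<dots> = 1 * (real m / (real m - 1)) ^ (m-1)" by simp
    also have "\<dots> \<le> ((1 + real (m-1) * (real m / (real m - 1))) / real (m-1+1)) ^ (m-1+1)"
      using that by (intro amgm_power) auto
    also have "\<dots> = pinning_factor (m+1)" using that by (simp add: pinning_factor_def of_nat_diff)
    finally show ?thesis .
  qed
  from assms(2,1) show ?thesis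
  proof (induction rule: dec_induct)
    case (step n)
    then show ?case using \<open>\<And>m. m \<ge> 2 \<Longrightarrow> pinning_factor m \<le> pinning_factor (m+1)\<close>[of n] by simp
  qed simp
qed

text \<open>The polynomial is the value of \<open>P(S \<le> 1) + c P(S = 0)\<close> for \<open>N\<close> equal Bernoulli variables, which
vanish with probability proportional to \<open>d\<close>, and one further variable, at the \<open>c\<close> for which the two
extremal configurations tie. It equals \<open>K\<close> when all variables are equal (\<open>d = 1\<close>) and when the
further one is pinned (\<open>d = m/N\<close>). The derivative factors completely, so that between these two
points the polynomial only dips.\<close>
lemma two_value_polynomial_bound:
  fixes d :: real
  assumes "N \<ge> 1" "0 \<le> d" "real N * d \<le> real N + 1"
  defines "m \<equiv> real N + 1" and "K \<equiv> pinning_factor (N+1)"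
  shows "d ^ (N-1) * (d + (m - real N * d) * real N - (m - real N * d) * d * (m - K)) \<le> K"
proof (cases "N = 1")
  case True
  then have "K = 2" by (simp add: K_def pinning_factor_def)
  with True show ?thesis by (simp add: m_def)
next
  case False
  then have N2: "N \<ge> 2" using assms by auto
  define n where "n = real N"
  have n2: "n \<ge> 2" using N2 by (simp add: n_def)
  have K2: "K \<ge> 2" unfolding K_def using N2 by (intro pinning_factor_ge_2) auto
  have "5/(4 * real (N+1)) > 0" by simp
  then have Km: "K < m" using pinning_factor_le[of "N+1"] N2 unfolding K_def m_def by linarith
  define f where "f = (\<lambda>d::real. d ^ (N-1) * (d + (m - n * d) * n - (m - n * d) * d * (m - K)))"
  have m_n: "m = n + 1" by (simp add: m_def n_def)
  have D: "(f has_real_derivative (n * m * d ^ (N-2) * ((d - 1) * ((m - K) * d - (n-1))))) (at d)" for d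
  proof -
    obtain k where k: "N = k + 2" using N2 by (metis add.commute le_Suc_ex)
    have nk: "n = real k + 2" by (simp add: n_def k)
    show ?thesis unfolding f_def k
      by (rule derivative_eq_intros refl | simp add: m_n nk)+ (simp add: algebra_simps power2_eq_square)
  qed
  have f1: "f 1 = K" by (simp add: f_def m_n algebra_simps)
  have fe: "f (m/n) = K"
  proof -
    have "f (m/n) = (m/n)^(N-1) * (m/n)" using n2 by (simp add: f_def)
    also have "\<dots> = (m/n)^N" using N2 by (metis Suc_diff_le diff_Suc_1 mult.commute numeral_2_eq_2 power_Suc Suc_1 Suc_le_D power_minus_mult less_le_trans pos2)
    also have "\<dots> = K" by (simp add: K_def pinning_factor_def m_def n_def add.commute)
    finally show ?thesis .
  qed
  have dn: "d \<le> m/n" using assms n2 by (simp add: n_def m_def field_simps)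
  have "f d \<le> K"
  proof -
    consider "d \<le> 1" | "1 \<le> d" "(m-K) * d \<le> n - 1" | "1 \<le> d" "(m-K)*d \<ge> n-1" by linarith
    then show ?thesis
    proof cases
      case 1
      have "f d \<le> f 1"
      proof (rule DERIV_nonneg_imp_nondecreasing[OF 1])
        fix x assume x: "d \<le> x" "x \<le> 1"
        have "(m-K) * x \<le> m - K" using x Km assms by (simp add: mult_left_le)
        then have "(x - 1) * ((m - K) * x - (n-1)) \<ge> 0"
          using x K2 by (intro mult_nonpos_nonpos) (auto simp: m_n)
        then have "n * m * x ^ (N-2) * ((x - 1) * ((m - K) * x - (n-1))) \<ge> 0"
          using x n2 assms(2) by (intro mult_nonneg_nonneg[where b = "(x - 1) * _"]) (auto simp: m_n)
        then show "\<exists>y. (f has_real_derivative y) (at x) \<and> 0 \<le> y" using D by blast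
      qed
      then show ?thesis using f1 by simp
    next
      case 2
      have "f d \<le> f 1"
      proof (rule DERIV_nonpos_imp_nonincreasing[OF 2(1)])
        fix x assume x: "1 \<le> x" "x \<le> d"
        have "(m-K) * x \<le> (m - K) * d" using x Km by (intro mult_left_mono) auto
        then have "(x - 1) * ((m - K) * x - (n-1)) \<le> 0"
          using x 2 by (intro mult_nonneg_nonpos) auto
        then have "n * m * x ^ (N-2) * ((x - 1) * ((m - K) * x - (n-1))) \<le> 0"
          using x n2 by (intro mult_nonneg_nonpos[where b = "(x - 1) * _"]) (auto simp: m_n)
        then show "\<exists>y. (f has_real_derivative y) (at x) \<and> y \<le> 0" using D by blast
      qed
      then show ?thesis using f1 by simp
    next
      case 3
      have "f d \<le> f (m/n)"
      proof (rule DERIV_nonneg_imp_nondecreasing[OF dn])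
        fix x assume x: "d \<le> x" "x \<le> m/n"
        have "(m-K) * x \<ge> (m - K) * d" using x Km by (intro mult_left_mono) auto
        then have "(x - 1) * ((m - K) * x - (n-1)) \<ge> 0"
          using x 3 by (intro mult_nonneg_nonneg) auto
        then have "n * m * x ^ (N-2) * ((x - 1) * ((m - K) * x - (n-1))) \<ge> 0"
          using x n2 assms(2) by (intro mult_nonneg_nonneg[where b = "(x - 1) * _"]) (auto simp: m_n)
        then show "\<exists>y. (f has_real_derivative y) (at x) \<and> 0 \<le> y" using D by blast
      qed
      then show ?thesis using fe by simp
    qed
  qed
  then show ?thesis by (simp add: f_def n_def)
qed

text \<open>Both sides are piecewise affine in \<open>c\<close>, and the left one has the smaller slope wherever the
right one is not constant, by the inequality of the means. Hence it suffices to consider the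
\<open>c\<close> at which the two terms of the maximum agree.\<close>
lemma two_value_bound:
  fixes a d c :: real
  assumes N: "N \<ge> 1" and a: "0 \<le> a" and d: "0 \<le> d"
    and e: "e = (a + real N * d) / (real N + 1)" "e > 0"
  shows "d ^ (N-1) * (a * d * (c - real N) + d + a * real N)
    \<le> e ^ N * max (pinning_factor (N+1)) ((1 + c) * e + (real N + 1) * (1 - e))"
proof -
  define m K where "m = real N + 1" and "K = pinning_factor (N+1)"
  have ae: "a = m * e - real N * d" using e by (simp add: m_def field_simps)
  define L where "L = (\<lambda>c. d ^ (N-1) * (a * d * (c - real N) + d + a * real N))"
  \<comment> \<open>at \<open>c0\<close> the two terms of the maximum agree\<close>
  define c0 where "c0 = real N - (m - K) / e"
  have pN: "d ^ (N-1) * d = d ^ N" "e ^ (N-1) * e = e ^ N"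
    using N by (metis power_minus_mult zero_less_one_class.zero_le_one less_le_trans zero_less_one)+
  have slope: "L c = L c0 + (c - c0) * (a * d ^ N)" for c
    unfolding L_def pN(1)[symmetric] by (simp add: algebra_simps)
  have L0: "L c0 \<le> K * e ^ N"
  proof -
    define t where "t = d / e"
    have dt: "d = e * t" using e(2) by (simp add: t_def)
    have "t ^ (N-1) * (t + (m - real N * t) * real N - (m - real N * t) * t * (m - K)) \<le> K"
      unfolding m_def K_def
    proof (rule two_value_polynomial_bound[OF N])
      show "0 \<le> t" using d e(2) by (simp add: t_def)
      have "0 \<le> e * (m - real N * t)" using a ae dt by (simp add: algebra_simps)
      then have "0 \<le> m - real N * t" using e(2) by (simp only: zero_le_mult_iff) auto
      then show "real N * t \<le> real N + 1" by (simp add: m_def)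
    qed
    then have "e ^ N * (t ^ (N-1) * (t + (m - real N * t) * real N - (m - real N * t) * t * (m - K))) \<le> e ^ N * K"
      using e by (intro mult_left_mono) auto
    moreover have "e ^ N * (t ^ (N-1) * (t + (m - real N * t) * real N - (m - real N * t) * t * (m - K))) = L c0"
    proof -
      have "d ^ (N-1) = e ^ (N-1) * t ^ (N-1)" by (simp add: dt power_mult_distrib)
      moreover have "a * d * (c0 - real N) + d + a * real N
         = e * (t + (m - real N * t) * real N - (m - real N * t) * t * (m - K))"
        unfolding c0_def ae dt using e by (simp add: field_simps)
      ultimately show ?thesis unfolding L_def pN(2)[symmetric] by simp
    qed
    ultimately show ?thesis by (simp add: mult.commute)
  qed
  have am: "a * d ^ N \<le> e ^ (N+1)" using amgm_power[OF a d, of N] e by (simp add: add.commute)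
  have ann: "0 \<le> a * d ^ N" using a d by simp
  have eN: "e ^ N \<ge> 0" using e by simp
  have "L c \<le> e ^ N * max K ((1 + c) * e + m * (1 - e))"
  proof (cases "c \<le> c0")
    case True
    then have "L c \<le> L c0" unfolding slope[of c] using ann by (simp add: mult_nonpos_nonneg)
    also have "\<dots> \<le> e ^ N * K" using L0 by (simp add: mult.commute)
    also have "\<dots> \<le> e ^ N * max K ((1 + c) * e + m * (1 - e))" using eN by (intro mult_left_mono) auto
    finally show ?thesis .
  next
    case False
    then have "L c \<le> K * e ^ N + (c - c0) * e ^ (N+1)"
      unfolding slope[of c] using L0 am by (intro add_mono mult_left_mono) auto
    also have "\<dots> = e ^ N * (K + (c - c0) * e)" by (simp add: algebra_simps)
    also have "K + (c - c0) * e = (1 + c) * e + m * (1 - e)"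
      proof -
      have "(m - K) / e * e = m - K" using e(2) by simp
      moreover have "K + (c - c0) * e = K + c * e - real N * e + (m - K) / e * e"
        unfolding c0_def by (simp add: algebra_simps)
      ultimately show ?thesis by (simp add: m_def algebra_simps)
    qed
    also have "e ^ N * ((1 + c) * e + m * (1 - e)) \<le> e ^ N * max K ((1 + c) * e + m * (1 - e))"
      using eN by (intro mult_left_mono) auto
    finally show ?thesis .
  qed
  then show ?thesis by (simp add: L_def K_def m_def)
qed

text \<open>The first term of the maximum is the probability that \<open>m - 1\<close> equal Bernoulli variables with
total mean \<open>\<mu> - 1\<close> vanish.\<close>
lemma pinned_form:
  assumes "m \<ge> 2"
  shows "(1 - \<mu> / m) ^ (m - 1) * pinning_factor m = ((real m - \<mu>) / (real m - 1)) ^ (m-1)"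
proof -
  have "(1 - \<mu> / m) * (real m / (real m - 1)) = (real m - \<mu>) / (real m - 1)"
  proof -
    have "(1 - \<mu> / m) * real m = real m - \<mu>" using assms by (simp add: field_simps)
    then show ?thesis by (metis times_divide_eq_right)
  qed
  then show ?thesis unfolding pinning_factor_def power_mult_distrib[symmetric] by (rule arg_cong)
qed

lemma extremal_bound_eq:
  assumes "m \<ge> 1" "\<mu> \<le> real m"
  shows "extremal_bound m c \<mu> = max ((1 - \<mu> / m) ^ (m - 1) * pinning_factor m) ((1 - \<mu> / m) ^ (m - 1) * ((1 + c) * (1 - \<mu> / m) + \<mu>))"
  unfolding extremal_bound_def using assms by (subst max_mult_distrib_left) auto

lemma extremal_bound_mono_c:
  assumes "m \<ge> 1" "\<mu> \<le> real m" "c \<le> c'"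
  shows "extremal_bound m c \<mu> \<le> extremal_bound m c' \<mu>"
  unfolding extremal_bound_def using assms
  by (intro mult_left_mono max.mono add_mono mult_right_mono zero_le_power) auto

text \<open>Conditioning on a Bernoulli summand with probability \<open>p\<close> turns the weight \<open>c\<close> into \<open>c + p/(1-p)\<close>.
Thus the left-hand side is a value for \<open>N + 1\<close> summands that are not yet balanced, and
balancing them does not decrease the maximum.\<close>
lemma extremal_bound_unit:
  assumes N: "N \<ge> 1" and p: "0 \<le> p" "p < 1" and mu: "0 \<le> \<mu>" "\<mu> \<le> real N" and c: "c \<ge> 0"
  shows "(1 - p) * extremal_bound N (c + p / (1-p)) \<mu> \<le> extremal_bound (N+1) c (\<mu> + p)"
proof -
  \<comment> \<open>probabilities of vanishing: for the new summand, for each of the others, and after balancing all of them\<close>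
  define a d e where "a = 1 - p" and "d = 1 - \<mu> / N" and "e = 1 - (\<mu> + p) / (N+1)"
  have a: "a > 0" "0 \<le> a" "a \<le> 1" and d: "d \<ge> 0" and mud: "\<mu> = real N * (1 - d)"
    using p mu N by (auto simp: a_def d_def field_simps)
  have e: "e = (a + real N * d) / (real N + 1)"
  proof -
    have "a + real N * d = real N + 1 - (\<mu> + p)" using N by (simp add: a_def d_def right_diff_distrib)
    then show ?thesis by (simp add: e_def diff_divide_distrib add.commute)
  qed
  have epos: "e > 0" unfolding e using a d N by (intro divide_pos_pos add_pos_nonneg) auto
  have B: "extremal_bound (N+1) c (\<mu> + p) = e ^ N * max (pinning_factor (N+1)) ((1 + c) * e + (real N + 1) * (1 - e))"
  proof -
    have "(\<mu> + p) = (real N + 1) * (1 - e)" by (simp add: e_def add.commute)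
    then show ?thesis unfolding extremal_bound_def using N by (simp add: e_def add.commute)
  qed
  have 1: "a * (d ^ (N-1) * pinning_factor N) \<le> e ^ N * max (pinning_factor (N+1)) ((1 + c) * e + (real N + 1) * (1 - e))"
  proof -
    have "a * (d ^ (N-1) * pinning_factor N) \<le> e ^ N * pinning_factor (N+1)"
    proof (cases "N = 1")
      case True
      then show ?thesis using d by (simp add: e pinning_factor_def)
    next
      case False
      with N have N2: "N \<ge> 2" by auto
      have k: "d ^ (N-1) * pinning_factor N = (real N * d / (real N - 1)) ^ (N-1)"
        unfolding pinning_factor_def power_mult_distrib[symmetric] by (simp add: mult.commute)
      have k': "e ^ N * pinning_factor (N+1) = ((a + real N * d) / N) ^ N"
      proof -
        have "e * (real (N+1) / (real (N+1) - 1)) = (a + real N * d) / N" by (simp add: e add.commute)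
        then show ?thesis unfolding pinning_factor_def by (metis add_diff_cancel_right' power_mult_distrib)
      qed
      have NN: "N - 1 + 1 = N" "real (N-1) = real N - 1" using N by auto
      have "a * (real N * d / (real N - 1)) ^ (N-1) \<le> ((a + real (N-1) * (real N * d / (real N - 1))) / real (N-1+1)) ^ (N-1+1)"
        using a d N2 by (intro amgm_power) auto
      also have "\<dots> = ((a + real N * d) / N) ^ N" unfolding NN using N2 by simp
      finally show ?thesis unfolding k k' .
    qed
    also have "\<dots> \<le> e ^ N * max (pinning_factor (N+1)) ((1 + c) * e + (real N + 1) * (1 - e))"
      using epos by (intro mult_left_mono) auto
    finally show ?thesis .
  qed
  have 2: "a * (d ^ (N-1) * ((1 + (c + p/(1-p))) * d + \<mu>)) \<le> e ^ N * max (pinning_factor (N+1)) ((1 + c) * e + (real N + 1) * (1 - e))"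
  proof -
    have "a * ((1 + (c + p/(1-p))) * d + \<mu>) = a * d * (c - real N) + d + a * real N"
    proof -
      have "a * (p/(1-p)) = 1 - a" using a by (simp add: a_def)
      moreover have "a * ((1 + (c + p/(1-p))) * d + \<mu>) = a * (1 + c) * d + (a * (p/(1-p))) * d + a * \<mu>"
        by (simp add: algebra_simps)
      ultimately have "a * ((1 + (c + p/(1-p))) * d + \<mu>) = a * (1 + c) * d + (1 - a) * d + a * \<mu>" by presburger
      then show ?thesis by (simp add: mud algebra_simps)
    qed
    then have "a * (d ^ (N-1) * ((1 + (c + p/(1-p))) * d + \<mu>)) = d ^ (N-1) * (a * d * (c - real N) + d + a * real N)"
      by (metis mult.left_commute)
    also have "\<dots> \<le> e ^ N * max (pinning_factor (N+1)) ((1 + c) * e + (real N + 1) * (1 - e))"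
      by (rule two_value_bound[OF N a(2) d e epos])
    finally show ?thesis .
  qed
  have "(1 - p) * extremal_bound N (c + p / (1-p)) \<mu> = max (a * (d ^ (N-1) * pinning_factor N)) (a * (d ^ (N-1) * ((1 + (c + p/(1-p))) * d + \<mu>)))"
    using N mu a by (subst extremal_bound_eq) (auto simp: a_def[symmetric] d_def[symmetric] max_mult_distrib_left)
  also have "\<dots> \<le> extremal_bound (N+1) c (\<mu> + p)" unfolding B using 1 2 by simp
  finally show ?thesis .
qed

lemma extremal_bound_nonneg: assumes "m \<ge> 1" "\<mu> \<le> real m" shows "extremal_bound m c \<mu> \<ge> 0"
proof -
  have "pinning_factor m \<ge> 0" using assms unfolding pinning_factor_def by (intro zero_le_power divide_nonneg_nonneg) auto
  then show ?thesis unfolding extremal_bound_def using assms by (intro mult_nonneg_nonneg zero_le_power) auto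
qed

text \<open>A further summand that vanishes almost surely leaves the left-hand side unchanged.\<close>
lemma extremal_bound_Suc: assumes "N \<ge> 1" "0 \<le> \<mu>" "\<mu> \<le> real N" shows "extremal_bound N 0 \<mu> \<le> extremal_bound (N+1) 0 \<mu>"
  using extremal_bound_unit[of N 0 \<mu> 0] assms by simp

lemma extremal_bound_limit: "(\<lambda>m. extremal_bound m 0 \<mu>) \<longlonglongrightarrow> exp (-\<mu>) * max (exp 1) (1 + \<mu>)"
proof -
  have 1: "(\<lambda>m. (1 - \<mu> / real m) ^ (m - 1)) \<longlonglongrightarrow> exp (-\<mu>)"
  proof -
    have "(\<lambda>m. (1 - \<mu> / real m) ^ m / (1 - \<mu> / real m)) \<longlonglongrightarrow> exp (-\<mu>) / (1 - 0)"
      using tendsto_exp_limit_sequentially[of "-\<mu>"]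
      by (intro tendsto_intros) (auto intro!: lim_const_over_n)
    moreover have "\<forall>\<^sub>F m in sequentially. (1 - \<mu> / real m) ^ m / (1 - \<mu> / real m) = (1 - \<mu> / real m) ^ (m - 1)"
      using eventually_gt_at_top[of "nat \<lceil>\<bar>\<mu>\<bar>\<rceil>"]
    proof eventually_elim
      case (elim m)
      then have "\<bar>\<mu>\<bar> < real m" by linarith
      then have "m > 0" "1 - \<mu> / real m \<noteq> 0" by (auto simp: field_simps)
      then show ?case by (simp add: power_eq_if)
    qed
    ultimately show ?thesis by (simp add: filterlim_cong)
  qed
  have 2: "pinning_factor \<longlonglongrightarrow> exp 1"
  proof (rule LIMSEQ_imp_Suc)
    have "(\<lambda>n. (1 + 1 / real n) ^ n) \<longlonglongrightarrow> exp 1" by (rule tendsto_exp_limit_sequentially)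
    moreover have "\<forall>\<^sub>F n in sequentially. (1 + 1 / real n) ^ n = pinning_factor (Suc n)"
      using eventually_gt_at_top[of 0]
      by eventually_elim (simp add: pinning_factor_def field_simps)
    ultimately show "(\<lambda>n. pinning_factor (Suc n)) \<longlonglongrightarrow> exp 1" by (simp add: filterlim_cong)
  qed
  have 3: "(\<lambda>m. (1 + 0) * (1 - \<mu> / real m) + \<mu>) \<longlonglongrightarrow> (1 + 0) * (1 - 0) + \<mu>"
    by (intro tendsto_intros lim_const_over_n)
  have "(\<lambda>m. extremal_bound m 0 \<mu>) \<longlonglongrightarrow> exp (-\<mu>) * max (exp 1) ((1 + 0) * (1 - 0) + \<mu>)"
    unfolding extremal_bound_def by (intro tendsto_mult tendsto_max 1 2 3)
  then show ?thesis by simp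
qed

lemma extremal_bound_le_poisson:
  assumes "N \<ge> 1" "0 \<le> \<mu>" "\<mu> \<le> real N"
  shows "extremal_bound N 0 \<mu> \<le> max (1 + \<mu>) (exp 1) * exp (-\<mu>)"
proof -
  have inc: "extremal_bound N 0 \<mu> \<le> extremal_bound (N + k) 0 \<mu>" for k
  proof (induction k)
    case (Suc k)
    have "1 \<le> N + k" "\<mu> \<le> real (N + k)" using assms by auto
    from extremal_bound_Suc[OF this(1) assms(2) this(2)] have "extremal_bound (N+k) 0 \<mu> \<le> extremal_bound (N + k + 1) 0 \<mu>" .
    with Suc show ?case by simp
  qed simp
  have "extremal_bound N 0 \<mu> \<le> exp (-\<mu>) * max (exp 1) (1 + \<mu>)"
  proof (rule LIMSEQ_le_const[OF extremal_bound_limit])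
    show "\<exists>M. \<forall>n\<ge>M. extremal_bound N 0 \<mu> \<le> extremal_bound n 0 \<mu>"
      using inc by (metis le_add_diff_inverse)
  qed
  then show ?thesis by (simp add: mult.commute max.commute)
qed

section \<open>The extremal bound as a function of the mean\<close>

definition pinned_prob :: "nat \<Rightarrow> real \<Rightarrow> real" where "pinned_prob N \<nu> = (1 - \<nu> / N) ^ (N - 1) * pinning_factor N"
definition binomial_prob :: "nat \<Rightarrow> real \<Rightarrow> real" where "binomial_prob N \<nu> = (1 - \<nu> / N) ^ (N - 1) * (1 + \<nu> * (1 - 1 / N))"

lemma extremal_bound_zero_eq: assumes "N \<ge> 1" "\<nu> \<le> real N" shows "extremal_bound N 0 \<nu> = max (pinned_prob N \<nu>) (binomial_prob N \<nu>)"
  using assms by (simp add: extremal_bound_eq pinned_prob_def binomial_prob_def algebra_simps)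

lemma pinned_prob_DERIV:
  assumes N: "N \<ge> 2"
  shows "((\<lambda>\<nu>. \<nu> * pinned_prob N \<nu>) has_real_derivative (1 - \<nu> / N) ^ (N - 2) * (1 - \<nu>) * pinning_factor N) (at \<nu>)"
proof -
  obtain k where k: "N = k + 2" using N by (metis add.commute le_Suc_ex)
  have n: "real N = real k + 2" "real N \<noteq> 0" by (simp_all add: k)
  have 1: "((\<lambda>\<nu>. \<nu> * ((1 - \<nu> / N) ^ (k+1) * pinning_factor N)) has_real_derivative
     ((1 - \<nu> / N) ^ (k+1) * pinning_factor N - \<nu> * (real k + 1) / N * (1 - \<nu> / N) ^ k * pinning_factor N)) (at \<nu>)"
    by (rule derivative_eq_intros refl | use n in simp)+
  have "(1 - \<nu> / N) ^ (k+1) * pinning_factor N - \<nu> * (real k + 1) / N * (1 - \<nu> / N) ^ k * pinning_factor N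
      = (1 - \<nu> / N) ^ k * pinning_factor N * ((1 - \<nu> / N) - \<nu> * (real k + 1) / N)" by (simp add: algebra_simps)
  also have "(1 - \<nu> / N) - \<nu> * (real k + 1) / N = 1 - \<nu> * real N / real N"
    by (simp add: n(1) diff_divide_distrib[symmetric] add_divide_distrib[symmetric] algebra_simps)
  also have "\<nu> * real N / real N = \<nu>" using n(2) by simp
  finally show ?thesis using 1 by (simp add: pinned_prob_def k mult_ac)
qed

lemma pinned_prob_decr:
  assumes N: "N \<ge> 2" and "1 \<le> x" "x \<le> y" "y \<le> real N"
  shows "y * pinned_prob N y \<le> x * pinned_prob N x"
proof (rule DERIV_nonpos_imp_nonincreasing[OF assms(3)])
  fix v assume v: "x \<le> v" "v \<le> y"
  have "(1 - v / N) ^ (N - 2) * (1 - v) * pinning_factor N \<le> 0"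
    using v assms pinning_factor_ge_2[OF N] by (intro mult_nonpos_nonneg mult_nonneg_nonpos zero_le_power) (auto simp: field_simps)
  then show "\<exists>d. ((\<lambda>\<nu>. \<nu> * pinned_prob N \<nu>) has_real_derivative d) (at v) \<and> d \<le> 0"
    using pinned_prob_DERIV[OF N] by blast
qed

lemma pinned_prob_incr:
  assumes N: "N \<ge> 2" and "x \<le> y" "y \<le> 1"
  shows "x * pinned_prob N x \<le> y * pinned_prob N y"
proof (rule DERIV_nonneg_imp_nondecreasing[OF assms(2)])
  fix v assume v: "x \<le> v" "v \<le> y"
  have "v \<le> 1" using v assms by simp
  then have "(1 - v / N) ^ (N - 2) * (1 - v) * pinning_factor N \<ge> 0"
    using v assms pinning_factor_ge_2[OF N] by (intro mult_nonneg_nonneg zero_le_power) (auto simp: field_simps)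
  then show "\<exists>d. ((\<lambda>\<nu>. \<nu> * pinned_prob N \<nu>) has_real_derivative d) (at v) \<and> 0 \<le> d"
    using pinned_prob_DERIV[OF N] by blast
qed

text \<open>The quadratic decides whether \<open>\<nu> binomial_prob N \<nu>\<close> decreases at \<open>\<nu> = t N/(N-1)\<close>. Divided by \<open>N\<close>,
it tends to \<open>t\<^sup>2 - t - 1\<close>, whose larger root \<open>1.618\<close> is only slightly below the limit \<open>e - 1\<close> of
\<open>pinning_factor N - 1\<close>. Therefore small \<open>N\<close> are treated with several lower bounds.\<close>
lemma critical_quadratic:
  fixes t :: real
  assumes N: "N \<ge> 2" and t: "pinning_factor N - 1 \<le> t"
  shows "t^2 * (real N + 1) - t * (real N - 2) - (real N - 1) \<ge> 0"
proof -
  have main: ?thesis if h: "s \<ge> 1" "s \<le> t" "s^2 * (real N + 1) - s * (real N - 2) - (real N - 1) \<ge> 0" for s :: real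
  proof -
    have "(t + s) * (real N + 1) \<ge> 2 * (real N + 1)" using h by (intro mult_right_mono) auto
    then have "(t - s) * ((t + s) * (real N + 1) - (real N - 2)) \<ge> 0"
      using h by (intro mult_nonneg_nonneg) auto
    with h show ?thesis by (simp add: power2_eq_square algebra_simps)
  qed
  consider "N \<le> 4" | "3 \<le> N" "N \<le> 7" | "7 \<le> N" "N \<le> 25" | "14 \<le> N" by linarith
  then show ?thesis
  proof cases
    case 1
    have "pinning_factor N \<ge> 2" using N by (rule pinning_factor_ge_2)
    then show ?thesis using t 1 by (intro main[of 1]) auto
  next
    case 2
    have "pinning_factor 3 \<le> pinning_factor N" using 2 by (intro pinning_factor_mono) auto
    moreover have "pinning_factor 3 = 9/4" by (simp add: pinning_factor_def power2_eq_square)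
    moreover have "real N \<le> 7" using 2 by simp
    ultimately show ?thesis using t by (intro main[of "5/4"]) (simp_all add: power2_eq_square field_simps)
  next
    case 3
    have "pinning_factor 7 \<le> pinning_factor N" using 3 by (intro pinning_factor_mono) auto
    moreover have "pinning_factor 7 \<ge> 5/2" by (simp add: pinning_factor_def power_divide)
    moreover have "real N \<le> 25" using 3 by simp
    ultimately show ?thesis using t by (intro main[of "3/2"]) (simp_all add: power2_eq_square field_simps)
  next
    case 4
    have "pinning_factor 14 \<le> pinning_factor N" using 4 by (intro pinning_factor_mono) auto
    moreover have "pinning_factor 14 \<ge> 262/100" by (simp add: pinning_factor_def power_divide)
    moreover have "real N \<ge> 14" using 4 by simp
    ultimately show ?thesis using t by (intro main[of "162/100"]) (simp_all add: power2_eq_square field_simps)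
  qed
qed

text \<open>The hypothesis says that \<open>x\<close> is at least the mean at which the binomial value overtakes the
pinned one. Below that mean the claim may fail.\<close>
lemma binomial_prob_decr:
  assumes N: "N \<ge> 2" and x: "pinning_factor N \<le> 1 + x * (1 - 1 / N)" and "x \<le> y" "y \<le> real N"
  shows "y * binomial_prob N y \<le> x * binomial_prob N x"
proof (rule DERIV_nonpos_imp_nonincreasing[OF assms(3)])
  fix v assume v: "x \<le> v" "v \<le> y"
  obtain k where k: "N = k + 2" using N by (metis add.commute le_Suc_ex)
  have n: "real N = real k + 2" "real N \<noteq> 0" "real N > 0" by (simp_all add: k)
  define q where "q = 1 - 1 / real N"
  have q: "q > 0" "q * N = real k + 1" using n by (auto simp: q_def field_simps)
  define w where "w = 1 - v / real N"
  have 1: "((\<lambda>\<nu>. \<nu> * ((1 - \<nu> / N) ^ (k+1) * (1 + \<nu> * q))) has_real_derivative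
     (w ^ k * (w * (1 + v * q) - q * v^2))) (at v)"
  proof -
    have "((\<lambda>\<nu>. (1 - \<nu> / N) ^ (k+1)) has_real_derivative real (k+1) * w ^ k * (- (1 / N))) (at v)"
    proof -
      have "((\<lambda>\<nu>. 1 - \<nu> / N) has_real_derivative - (1 / N)) (at v)"
        using n(3) by (auto intro!: derivative_eq_intros)
      from DERIV_power[OF this, of "k+1"] show ?thesis by (simp add: w_def mult_ac)
    qed
    moreover have "real (k+1) * (1 / N) = q" using q n by (simp add: field_simps)
    then have "real (k+1) * w ^ k * (- (1 / N)) = - q * w ^ k" by (metis mult.commute mult.left_commute mult_minus_left mult_minus_right)
    ultimately have d1: "((\<lambda>\<nu>. (1 - \<nu> / N) ^ (k+1)) has_real_derivative - q * w ^ k) (at v)" by simp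
    have d2: "((\<lambda>\<nu>. \<nu> * (1 + \<nu> * q)) has_real_derivative 1 + 2 * q * v) (at v)"
      by (rule derivative_eq_intros refl | simp)+
    have "((\<lambda>\<nu>. (\<nu> * (1 + \<nu> * q)) * (1 - \<nu> / N) ^ (k+1)) has_real_derivative
       (1 + 2 * q * v) * (1 - v / N) ^ (k+1) + (- q * w ^ k) * (v * (1 + v * q))) (at v)"
      by (rule DERIV_mult[OF d2 d1])
    moreover have "(1 + 2 * q * v) * (1 - v / N) ^ (k+1) + (- q * w ^ k) * (v * (1 + v * q))
       = w ^ k * ((1 + 2 * q * v) * w - q * v * (1 + v * q))"
      unfolding w_def[symmetric] by (simp add: algebra_simps)
    moreover have "(1 + 2 * q * v) * w - q * v * (1 + v * q) = w * (1 + v * q) - q * v^2"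
    proof -
      have w: "w = 1 - v * (1 - q)" by (simp add: w_def q_def)
      show ?thesis unfolding w by (simp add: algebra_simps power2_eq_square)
    qed
    ultimately show ?thesis by (simp add: mult.assoc mult.commute mult.left_commute)
  qed
  define t where "t = v * q"
  have t: "pinning_factor N - 1 \<le> t" 
  proof -
    have "x * q \<le> v * q" using v q by (intro mult_right_mono) auto
    then show ?thesis using x unfolding q_def[symmetric] t_def by linarith
  qed
  have "t * N = v * (real N - 1)" using q(2) n by (simp add: t_def mult.assoc)
  then have vt: "v = t * N / (real N - 1)" using n by simp
  have weq: "w = 1 - t/(real N - 1)" using n by (simp add: w_def vt)
  have tv: "t * v = t * (t * N / (real N - 1))" using vt by (rule arg_cong)
  have "q * v^2 = t * v" by (simp add: t_def power2_eq_square)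
  then have "w * (1 + v * q) - q * v^2 = w * (1 + t) - t * v" by (simp add: t_def)
  also have "\<dots> = (1 - t/(real N - 1)) * (1 + t) - t * (t * N / (real N - 1))"
    by (simp only: weq tv)
  also have "\<dots> = - (t^2 * (real N + 1) - t * (real N - 2) - (real N - 1)) / (real N - 1)"
  proof -
    define M where "M = real N - 1"
    have M: "real N = M + 1" "M > 0" using n by (auto simp: M_def)
    show ?thesis unfolding M(1) using M(2) by (simp add: field_simps power2_eq_square)
  qed
  also have "\<dots> \<le> 0" using critical_quadratic[OF N t] n by (intro divide_nonpos_pos) auto
  finally have "w ^ k * (w * (1 + v * q) - q * v^2) \<le> 0"
    using v assms n by (intro mult_nonneg_nonpos zero_le_power) (auto simp: field_simps w_def)
  then show "\<exists>d. ((\<lambda>\<nu>. \<nu> * binomial_prob N \<nu>) has_real_derivative d) (at v) \<and> d \<le> 0"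
  proof -
    have "N - 1 = k + 1" by (simp add: k)
    then have "(\<lambda>\<nu>. \<nu> * binomial_prob N \<nu>) = (\<lambda>\<nu>. \<nu> * ((1 - \<nu> / N) ^ (k+1) * (1 + \<nu> * q)))"
      unfolding binomial_prob_def q_def by (simp only:)
    with 1 \<open>w ^ k * (w * (1 + v * q) - q * v^2) \<le> 0\<close> show ?thesis by metis
  qed
qed

text \<open>When a sum with mean \<open>x\<close> is stretched to mean \<open>y\<close>, the bound shrinks at least by the factor \<open>x/y\<close>. The
product is considered because the chord estimate costs the inverse of this factor.\<close>
lemma extremal_bound_mean_decr:
  assumes N: "N \<ge> 2" and x: "1 \<le> x" "x \<le> y" "y \<le> real N"
  shows "y * extremal_bound N 0 y \<le> x * extremal_bound N 0 x"
proof -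
  have m: "v * extremal_bound N 0 v = max (v * pinned_prob N v) (v * binomial_prob N v)" if "1 \<le> v" "v \<le> real N" for v
    using that N by (simp add: extremal_bound_zero_eq max_mult_distrib_left)
  have "y * pinned_prob N y \<le> x * pinned_prob N x" using N x by (rule pinned_prob_decr)
  moreover have "y * binomial_prob N y \<le> max (x * pinned_prob N x) (x * binomial_prob N x)"
  proof (cases "pinning_factor N \<le> 1 + x * (1 - 1 / N)")
    case True
    then show ?thesis using binomial_prob_decr[OF N True x(2,3)] by (simp add: le_max_iff_disj)
  next
    case False
    show ?thesis
    proof (cases "pinning_factor N \<le> 1 + y * (1 - 1 / N)")
      case F: False
      have "binomial_prob N y \<le> pinned_prob N y" unfolding binomial_prob_def pinned_prob_def
        using F x N by (intro mult_left_mono zero_le_power) auto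
      then have "y * binomial_prob N y \<le> y * pinned_prob N y" using x by (intro mult_left_mono) auto
      then show ?thesis using pinned_prob_decr[OF N x] by (simp add: le_max_iff_disj)
    next
      case True
      \<comment> \<open>at \<open>c\<close> the pinned and the binomial value agree\<close>
      define c where "c = (pinning_factor N - 1) / (1 - 1 / N)"
      have q: "1 - 1 / real N > 0" using N by (simp add: field_simps)
      have c: "pinning_factor N = 1 + c * (1 - 1 / N)" using q by (simp add: c_def)
      have xc: "x \<le> c" using False q unfolding c_def by (simp add: pos_le_divide_eq)
      have cy: "c \<le> y" using True q unfolding c_def by (simp add: pos_divide_le_eq)
      have "y * binomial_prob N y \<le> c * binomial_prob N c" using c cy x by (intro binomial_prob_decr[OF N]) auto
      also have "\<dots> = c * pinned_prob N c" using c by (simp add: binomial_prob_def pinned_prob_def)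
      also have "\<dots> \<le> x * pinned_prob N x" using xc cy x by (intro pinned_prob_decr[OF N]) auto
      finally show ?thesis by (simp add: le_max_iff_disj)
    qed
  qed
  ultimately show ?thesis using x by (simp add: m)
qed

section \<open>Means close to the threshold\<close>

text \<open>Here \<open>1 + x\<close> is the mean of the rescaled sum \<open>R/z\<close>, \<open>A\<close> stands for \<open>P(R \<le> z)\<close>, \<open>q\<close> for \<open>P(R = 0)\<close> and \<open>1 - \<delta>\<close>
for the total mean. The bound \<open>M1\<close> comes from the chord and is useful for large \<open>q\<close>; the bound \<open>M2\<close>
comes from \<open>P(R \<le> 1) \<le> 1\<close> and is useful for small \<open>q\<close>. If both exceeded \<open>T\<close>, then eliminating
\<open>q\<close> would give a contradiction. For \<open>c \<le> 1\<close> the linear bound \<open>1 + \<delta>\<close> for \<open>T\<close> suffices; for larger \<open>c\<close> the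
excess \<open>c - 1\<close> is paid for by the quadratic term. For \<open>x > \<beta>\<close> the bound \<open>M1\<close> alone suffices.\<close>
lemma window_ineq:
  fixes \<beta> \<theta> z s x y \<delta> c q A G T :: real
  assumes b: "0 < \<beta>" "\<beta> \<le> 1/2" and th: "0 \<le> \<theta>" "\<theta> \<le> 1"
    and defs: "z = 1 - \<beta>" "s = 1 - \<beta> * \<theta>" "y = \<beta> * (1 - \<theta>)" "\<delta> = s - z * (1 + x)"
    and x: "z * (1 + x) \<le> 1"
    and A: "x \<le> 0 \<Longrightarrow> A \<le> 1" "0 \<le> x \<Longrightarrow> A \<le> 1 - x + x^2/2"
    and q: "q \<ge> 0" and c: "c \<ge> 0"
    and M1: "z * G \<le> s * A - y * q" and M2: "G \<le> \<theta> * A + (1 - \<theta>) * (1 + c * q)"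
    and T: "1 + \<delta> \<le> T"
    and C: "1 < c \<Longrightarrow> \<delta> \<ge> 0 \<and> 1 + \<delta> + \<delta>^2/4 \<le> T \<and> c - 1 \<le> max (\<delta>/2) (\<delta> - 1/4)"
  shows "G \<le> T"
proof (rule ccontr)
  assume "\<not> G \<le> T"
  then have GT: "T < G" by simp
  define \<tau> where "\<tau> = T - 1 - \<delta>"
  have tau: "\<tau> \<ge> 0" "T = 1 + \<delta> + \<tau>" using T by (auto simp: \<tau>_def)
  have z: "1/2 \<le> z" "z \<le> 1" "z > 0" and y: "0 \<le> y" "y \<le> \<beta>" and sy: "s = z + y" and s: "0 \<le> s" "s \<le> 1"
  proof -
    have "\<beta> * \<theta> \<le> 1/2 * 1" using b th by (intro mult_mono) auto
    moreover have "0 \<le> \<beta> * \<theta>" "0 \<le> \<beta> * (1 - \<theta>)" using b th by simp_all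
    ultimately have "\<beta> * \<theta> \<le> 1/2" "0 \<le> \<beta> * \<theta>" "0 \<le> \<beta> * (1 - \<theta>)" by simp_all
    then show "0 \<le> s" "s \<le> 1" "1/2 \<le> z" "z \<le> 1" "z > 0" "0 \<le> y" "y \<le> \<beta>" "s = z + y"
      using b th by (auto simp: defs algebra_simps)
  qed
  have dl: "\<delta> = y - z * x" by (simp add: defs(4) sy algebra_simps)
  \<comment> \<open>the bounds \<open>M1\<close> and \<open>M2\<close> under the assumption \<open>T < G\<close>\<close>
  have zT: "z * T < s * A - y * q" using M1 GT z mult_strict_left_mono[of T G z] by linarith
  have yq: "0 \<le> y * q" using y q by simp
  have M2T: "T < \<theta> * A + (1 - \<theta>) * (1 + c * q)" using M2 GT by linarith
  have ytheta: "\<beta> * ((1 - \<theta>) * (c * q)) = c * (y * q)" by (simp add: defs)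
  have bz: "\<beta> + c * z \<ge> 1" if "c \<ge> 1" 
  proof -
    have "1 * z \<le> c * z" using that z by (intro mult_right_mono) auto
    then show ?thesis using defs(1) by linarith
  qed
  consider "x \<le> 0" | "0 < x" "x \<le> \<beta>" | "\<beta> < x" by linarith
  then show False
  proof cases
    case 1
    then have "A \<le> 1" by (rule A)
    then have sA: "s * A \<le> s" "\<theta> * A \<le> \<theta>" using s th by (auto simp: mult_left_le)
    have e1: "y * q < \<beta> * y + z^2 * x - z * \<tau>"
    proof -
      have "z * T = z + z * y - z^2 * x + z * \<tau>" by (simp add: tau dl algebra_simps power2_eq_square)
      moreover have "y - z * y = \<beta> * y" by (simp add: defs algebra_simps)
      ultimately show ?thesis using zT sA sy by linarith
    qed
    have "\<delta> + \<tau> < (1 - \<theta>) * (c * q)" using M2T sA tau by (simp add: algebra_simps)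
    then have "\<beta> * (\<delta> + \<tau>) < \<beta> * ((1 - \<theta>) * (c * q))" using b by simp
    then have e2: "\<beta> * (\<delta> + \<tau>) < c * (y * q)" by (simp only: ytheta)
    have "c * (y * q) \<le> c * (\<beta> * y + z^2 * x - z * \<tau>)" using e1 c by (intro mult_left_mono) auto
    with e2 have e3: "\<beta> * (\<delta> + \<tau>) < c * (\<beta> * y + z^2 * x - z * \<tau>)" by simp
    have zx: "z * x \<le> 0" using 1 z by (simp add: mult_nonneg_nonpos)
    show False
    proof (cases "c \<le> 1")
      case True
      have "c * (\<beta> * y + z^2 * x - z * \<tau>) \<le> 1 * (\<beta> * y + z^2 * x - z * \<tau>)"
        using True e1 yq by (intro mult_right_mono) linarith+
      with e3 have "\<beta> * (\<delta> + \<tau>) < \<beta> * y + z^2 * x - z * \<tau>" by simp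
      moreover have "\<beta> * (\<delta> + \<tau>) - (\<beta> * y + z^2 * x - z * \<tau>) = \<tau> - z * x"
        by (simp add: dl defs algebra_simps power2_eq_square)
      ultimately show False using tau zx by linarith
    next
      case False
      then have c1: "c > 1" by simp
      have "(c - 1) * (\<beta> * y) > (\<beta> + c * z) * (\<tau> - z * x)"
        using e3 by (simp add: dl algebra_simps power2_eq_square)
      moreover have "(\<beta> + c * z) * (\<tau> - z * x) \<ge> 1 * (\<tau> - z * x)"
        using bz c1 tau zx by (intro mult_right_mono) auto
      ultimately have e4: "(c - 1) * (\<beta> * y) > \<tau> + \<delta> - y" by (simp add: dl)
      have tau4: "\<tau> \<ge> \<delta>^2/4" and d0: "\<delta> \<ge> 0" and cm: "c - 1 \<le> max (\<delta>/2) (\<delta> - 1/4)"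
        using C[OF c1] by (auto simp: tau)
      have yd: "y \<le> \<delta>" using zx by (simp add: dl)
      show False
      proof (cases "\<delta> \<le> 1/2")
        case True
        then have "c - 1 \<le> \<delta>/2" using cm by auto
        then have "(c - 1) * (\<beta> * y) \<le> (\<delta>/2) * (1/2 * \<delta>)"
          using b y yd d0 by (intro mult_mono) auto
        with e4 tau4 yd show False by (simp add: power2_eq_square)
      next
        case False
        then have "c - 1 \<le> \<delta> - 1/4" using cm by auto
        then have "(c - 1) * (\<beta> * y) \<le> (\<delta> - 1/4) * (1/2 * (1/2))"
          using b y False by (intro mult_mono) auto
        moreover have "(\<delta> - 1/2) * (\<delta>/4 + 7/8) \<ge> 0" using False by (intro mult_nonneg_nonneg) auto
        moreover have "(\<delta> - 1/2) * (\<delta>/4 + 7/8) = \<delta>^2/4 + 3*\<delta>/4 - 7/16"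
          by (simp add: field_simps power2_eq_square)
        moreover define P where "P = (c - 1) * (\<beta> * y)"
        ultimately have "P \<le> \<delta>/4 - 1/16" "\<delta>^2/4 + 3*\<delta>/4 - 7/16 \<ge> 0" by simp_all
        moreover have "P > \<tau> + \<delta> - y" using e4 by (simp add: P_def)
        ultimately show False using tau4 y b by linarith
      qed
    qed
  next
    case 2
    have A': "A \<le> 1 - x + x^2/2" using 2 A by simp
    have sA: "s * A \<le> s * (1 - x + x^2/2)" "\<theta> * A \<le> \<theta> * (1 - x + x^2/2)"
      using A' s th by (auto intro: mult_left_mono)
    have e1: "y * q < y * (\<beta> - x) - z * \<tau>"
    proof -
      have "z * T = z + z * y - z^2 * x + z * \<tau>" by (simp add: tau dl algebra_simps power2_eq_square)
      moreover have "s * (1 - x + x^2/2) - (z + z * y - z^2 * x) = y * (\<beta> - x) - x * (z * \<beta> - s * x / 2)"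
        by (simp add: sy defs(1) algebra_simps power2_eq_square)
      moreover have "x * (z * \<beta> - s * x / 2) \<ge> 0"
      proof -
        have "s * x \<le> 1 * \<beta>" using 2 s b by (intro mult_mono) auto
        also have "\<dots> \<le> 2 * z * \<beta>" using z b by simp
        finally show ?thesis using 2 by (intro mult_nonneg_nonneg) auto
      qed
      ultimately show ?thesis using zT sA by linarith
    qed
    have "\<delta> + \<tau> + \<theta> * (x - x^2/2) < (1 - \<theta>) * (c * q)" using M2T sA tau by (simp add: algebra_simps)
    then have "\<beta> * (\<delta> + \<tau> + \<theta> * (x - x^2/2)) < \<beta> * ((1 - \<theta>) * (c * q))" using b by simp
    then have e2: "\<beta> * (\<delta> + \<tau> + \<theta> * (x - x^2/2)) < c * (y * q)" by (simp only: ytheta)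
    have "\<beta> * (\<delta> + \<tau> + \<theta> * (x - x^2/2)) - (y * (\<beta> - z * x) + \<beta> * \<tau>) = \<beta> * \<theta> * x * (\<beta> - x/2)"
      by (simp add: dl defs algebra_simps power2_eq_square)
    moreover have "\<beta> * \<theta> * x * (\<beta> - x/2) \<ge> 0" using b th 2 by (intro mult_nonneg_nonneg) auto
    ultimately have e3: "y * (\<beta> - z * x) + \<beta> * \<tau> < c * (y * q)" using e2 by linarith
    have "c * (y * q) \<le> c * (y * (\<beta> - x) - z * \<tau>)" using e1 c by (intro mult_left_mono) auto
    with e3 have e3: "y * (\<beta> - z * x) + \<beta> * \<tau> < c * (y * (\<beta> - x) - z * \<tau>)" by simp
    have ex: "y * (\<beta> - z * x) = y * (\<beta> - x) + y * \<beta> * x" by (simp add: defs(1) algebra_simps)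
    have ybx: "y * \<beta> * x \<ge> 0" using y b 2 by simp
    have zt: "z * \<tau> \<ge> 0" "\<beta> * \<tau> \<ge> 0" using z b tau by auto
    show False
    proof (cases "c \<le> 1")
      case True
      have "c * (y * (\<beta> - x) - z * \<tau>) \<le> 1 * (y * (\<beta> - x) - z * \<tau>)"
        using True e1 yq by (intro mult_right_mono) linarith+
      also have "1 * (y * (\<beta> - x) - z * \<tau>) = y * (\<beta> - z * x) - y * \<beta> * x - z * \<tau>" using ex by simp
      finally have "c * (y * (\<beta> - x) - z * \<tau>) \<le> y * (\<beta> - z * x) + \<beta> * \<tau>" using ybx zt by linarith
      with e3 show False by simp
    next
      case False
      then have c1: "c > 1" by simp
      have "(c - 1) * (y * (\<beta> - x)) > y * \<beta> * x + (\<beta> + c * z) * \<tau>"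
        using e3 ex by (simp add: algebra_simps)
      moreover have "(\<beta> + c * z) * \<tau> \<ge> 1 * \<tau>"
        using bz c1 tau by (intro mult_right_mono) auto
      ultimately have e4: "(c - 1) * (y * (\<beta> - x)) > y * \<beta> * x + \<tau>" by simp
      have tau4: "\<tau> \<ge> \<delta>^2/4" and d0: "\<delta> \<ge> 0" and cm: "c - 1 \<le> max (\<delta>/2) (\<delta> - 1/4)"
        using C[OF c1] by (auto simp: tau)
      have zx: "z * x > 0" using z 2 by simp
      have yd: "y = \<delta> + z * x" by (simp add: dl)
      have "\<delta> < 1/2" using yd zx y b by linarith
      then have cm: "c - 1 \<le> \<delta>/2" using cm by auto
      have "(c - 1) * (y * (\<beta> - x)) \<le> (\<delta>/2) * (y * (\<beta> - x))"
        using cm y 2 by (intro mult_right_mono) auto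
      also have "\<dots> = \<delta> * (\<delta>/2) * (\<beta> - x) + (z * x) * (\<delta>/2) * (\<beta> - x)"
        unfolding yd by (simp add: field_simps)
      also have "\<dots> \<le> \<delta> * (\<delta>/2) * (1/2) + (1 * x) * y * \<beta>"
        using d0 2 b z yd zx y by (intro add_mono mult_mono mult_nonneg_nonneg) auto
      finally show False using e4 tau4 by (simp add: power2_eq_square algebra_simps)
    qed
  next
    case 3
    have zx: "z * x \<le> \<beta>" using x by (simp add: defs algebra_simps)
    have A': "A \<le> 1 - x + x^2/2" using 3 b A by simp
    have sA: "s * A \<le> s * (1 - x + x^2/2)" using A' s by (auto intro: mult_left_mono)
    have P0: "z * x * (\<beta> - x/2) \<ge> 0"
    proof -
      have "1/2 * x \<le> z * x" using z 3 b by (intro mult_right_mono) auto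
      then have "\<beta> - x/2 \<ge> 0" using zx by linarith
      then show ?thesis using 3 b z by (intro mult_nonneg_nonneg) auto
    qed
    have P1: "\<beta> * x * (1 + z) - \<beta>^2 - x^2/2 \<ge> 0"
    proof -
      have "(x - \<beta>) * (\<beta> - z * x) \<ge> 0" using 3 zx by (intro mult_nonneg_nonneg) auto
      moreover have "(2 * z - 1) * (\<beta> * (x * (1 + z) - \<beta>)) \<ge> 0"
      proof -
        have "\<beta> * 1 \<le> x * (1 + z)" using 3 z b by (intro mult_mono) auto
        then show ?thesis using z b by (intro mult_nonneg_nonneg) auto
      qed
      ultimately have "2 * z * (\<beta> * x * (1 + z) - \<beta>^2 - x^2/2) \<ge> 0"
        by (simp add: algebra_simps power2_eq_square)
      then show ?thesis using z by (simp add: zero_le_mult_iff)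
    qed
    have "z * (1 + \<delta>) - s * (1 - x + x^2/2) = \<theta> * (z * x * (\<beta> - x/2)) + (1 - \<theta>) * (\<beta> * x * (1 + z) - \<beta>^2 - x^2/2)"
      by (simp add: dl sy defs(1) defs(3) field_simps power2_eq_square)
    also have "\<dots> \<ge> 0" 
      by (rule add_nonneg_nonneg[OF mult_nonneg_nonneg[OF th(1) P0] mult_nonneg_nonneg[OF _ P1]]) (use th in simp)
    finally have "s * (1 - x + x^2/2) \<le> z * (1 + \<delta>)" by simp
    moreover have "z * (1 + \<delta>) \<le> z * T" using T z by (intro mult_left_mono) auto
    ultimately show False using zT sA yq by linarith
  qed
qed

lemma pinned_prob_eq: assumes "N \<ge> 2" shows "pinned_prob N \<nu> = ((real N - \<nu>) / (real N - 1)) ^ (N-1)"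
  unfolding pinned_prob_def using pinned_form[OF assms, of \<nu>] by simp

text \<open>For large \<open>N\<close> this is the numerical fact \<open>2 \<le> exp (3/4)\<close>. It compares \<open>\<nu> pinned_prob N \<nu>\<close> at \<open>3/2\<close> and at
\<open>3/4\<close>, which lie on different sides of the maximum at \<open>1\<close>.\<close>
lemma pinned_prob_double: assumes N: "N \<ge> 2" shows "2 * pinned_prob N (3/2) \<le> pinned_prob N (3/4)"
proof -
  define v where "v = real N - 3/2"
  have v: "v \<ge> 1/2" using N by (simp add: v_def)
  have n: "real (N-1) = v + 1/2" using N by (simp add: v_def of_nat_diff)
  have "2 \<le> 1 + real (N-1) * (3/4/v) + real (N-1) * (real (N-1) - 1) / 2 * (3/4/v)^2"
  proof -
    have "1/16 \<le> v * v * 4" using mult_mono[of "1/2" v "1/2" v] v by simp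
    then have "0 \<le> v * v * (1/32) + v * (3/8) - 9/128" using v by simp
    then have "0 \<le> (v * v * (1/32) + v * (3/8) - 9/128) / (v * v)" using v by simp
    also have "\<dots> = 1 + real (N-1) * (3/4/v) + real (N-1) * (real (N-1) - 1) / 2 * (3/4/v)^2 - 2"
      unfolding n using v by (simp add: field_simps power2_eq_square)
    finally show ?thesis by linarith
  qed
  also have "\<dots> \<le> (1 + 3/4/v) ^ (N-1)" using v by (intro bernoulli_second_order) auto
  finally have 1: "2 \<le> (1 + 3/4/v) ^ (N-1)" .
  have "pinned_prob N (3/4) = (1 + 3/4/v) ^ (N-1) * pinned_prob N (3/2)"
  proof -
    have "(real N - 3/4) = (1 + 3/4/v) * (real N - 3/2)" using v by (simp add: v_def field_simps)
    then show ?thesis using N by (simp add: pinned_prob_eq power_mult_distrib power_divide)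
  qed
  moreover have "pinned_prob N (3/2) \<ge> 0" using N by (simp add: pinned_prob_eq)
  ultimately show ?thesis using mult_right_mono[OF 1] by simp
qed

lemma pinned_prob_ge:
  assumes N: "N \<ge> 1" and mu: "\<mu> \<le> real N + 1"
  shows "1 + (1 - \<mu>) \<le> pinned_prob (N+1) \<mu>"
    and "N \<ge> 2 \<Longrightarrow> \<mu> \<le> 1 \<Longrightarrow> 1 + (1 - \<mu>) + (1 - \<mu>)^2 / 4 \<le> pinned_prob (N+1) \<mu>"
proof -
  have w: "pinned_prob (N+1) \<mu> = (1 + (1 - \<mu>) / N) ^ N"
  proof -
    have "(real (N+1) - \<mu>) / (real (N+1) - 1) = 1 + (1 - \<mu>) / N" using N by (simp add: field_simps)
    then show ?thesis using N pinned_prob_eq[of "N+1" \<mu>] by simp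
  qed
  have "1 + real N * ((1 - \<mu>) / N) \<le> (1 + (1 - \<mu>) / N) ^ N"
    using N mu by (intro Bernoulli_inequality) (simp add: field_simps)
  then show "1 + (1 - \<mu>) \<le> pinned_prob (N+1) \<mu>" unfolding w using N by simp
  assume N2: "N \<ge> 2" and mu1: "\<mu> \<le> 1"
  have "1 + real N * ((1 - \<mu>) / N) + real N * (real N - 1) / 2 * ((1 - \<mu>) / N)^2 \<le> (1 + (1 - \<mu>) / N) ^ N"
    using mu1 N2 by (intro bernoulli_second_order) auto
  moreover have "real N * (real N - 1) / 2 * ((1 - \<mu>) / N)^2 = (1 - \<mu>)^2 * ((real N - 1) / (2 * N))"
    using N2 by (simp add: power2_eq_square field_simps)
  moreover have "(1 - \<mu>)^2 * (1/4) \<le> (1 - \<mu>)^2 * ((real N - 1) / (2 * N))"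
    using N2 by (intro mult_left_mono) (auto simp: field_simps)
  ultimately show "1 + (1 - \<mu>) + (1 - \<mu>)^2 / 4 \<le> pinned_prob (N+1) \<mu>" unfolding w
  proof -
    assume a: "1 + real N * ((1 - \<mu>) / N) + real N * (real N - 1) / 2 * ((1 - \<mu>) / N)^2 \<le> (1 + (1 - \<mu>) / N) ^ N"
      "real N * (real N - 1) / 2 * ((1 - \<mu>) / N)^2 = (1 - \<mu>)^2 * ((real N - 1) / (2 * N))"
      "(1 - \<mu>)^2 * (1/4) \<le> (1 - \<mu>)^2 * ((real N - 1) / (2 * N))"
    moreover have "real N * ((1 - \<mu>) / N) = 1 - \<mu>" using N2 by simp
    ultimately show "1 + (1 - \<mu>) + (1 - \<mu>)^2 / 4 \<le> (1 + (1 - \<mu>) / N) ^ N" by linarith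
  qed
qed

lemma pinned_prob_le_quadratic:
  assumes N: "N \<ge> 2" and "0 \<le> x" "x \<le> 1"
  shows "pinned_prob N (1 + x) \<le> 1 - x + x^2/2"
proof -
  have "(real N - (1 + x)) / (real N - 1) = 1 - x / (real N - 1)" using N by (simp add: field_simps)
  moreover have "real (N-1) * (x / (real N - 1)) = x" using N by (simp add: of_nat_diff)
  moreover have "x / (real N - 1) \<le> 1" using N assms by (simp add: field_simps)
  ultimately show ?thesis
    using power_one_minus_le[of "x / (real N - 1)" "N-1"] N assms by (simp add: pinned_prob_eq)
qed

lemma extremal_bound_eq_pinned:
  assumes N: "N \<ge> 2" and "\<nu> \<le> 3/2"
  shows "extremal_bound N 0 \<nu> = pinned_prob N \<nu>"
proof -
  have n: "\<nu> \<le> real N" using assms by simp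
  have "1 + \<nu> * (1 - 1/N) \<le> pinning_factor N"
  proof -
    have "\<nu> * (1 - 1/N) \<le> 3/2 * (1 - 1/N)" using assms by (intro mult_right_mono) auto
    also have "\<dots> \<le> 3/2 - 1/(2 * (real N - 1))" using N by (simp add: field_simps)
    finally show ?thesis using pinning_factor_ge[OF N] by simp
  qed
  then have "binomial_prob N \<nu> \<le> pinned_prob N \<nu>" unfolding binomial_prob_def pinned_prob_def
    using n N by (intro mult_left_mono zero_le_power) auto
  then show ?thesis using n N by (simp add: extremal_bound_zero_eq)
qed

text \<open>The value \<open>c\<close> is the one for which the two extremal configurations tie. It exceeds \<open>1\<close> only if
the mean is at most \<open>1\<close>, and then by a controlled amount.\<close>
lemma critical_c_bound:
  assumes m: "m \<ge> 3" and mu: "0 \<le> \<mu>" "\<mu> < real m"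
    and c: "c = (pinning_factor m - \<mu>) / (1 - \<mu> / m) - 1" "c > 1"
  shows "\<mu> \<le> 1" "c - 1 \<le> max ((1 - \<mu>)/2) ((1 - \<mu>) - 1/4)"
proof -
  define u \<delta> where "u = 1 / real m" and "\<delta> = 1 - \<mu>"
  have u: "u > 0" "u \<le> 1/3" using m by (auto simp: u_def field_simps)
  have mu_eq: "\<mu> = 1 - \<delta>" by (simp add: \<delta>_def)
  define e where "e = 1 - \<mu> / m"
  have e: "e > 0" "e = 1 - u + \<delta> * u" using mu m by (auto simp: e_def u_def mu_eq field_simps)
  define num where "num = -1/4 + 3*u/4 + \<delta> * (1 - 2*u)"
  have "(c - 1) * e = pinning_factor m - \<mu> - 2 * e" unfolding c(1) e_def[symmetric] using e by (simp add: field_simps)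
  also have "\<dots> \<le> 11/4 - 5*u/4 - \<mu> - 2 * e" using pinning_factor_le[of m] m by (simp add: u_def)
  also have "\<dots> = num" by (simp add: e mu_eq num_def algebra_simps)
  finally have n: "(c - 1) * e \<le> num" .
  moreover have "(c - 1) * e > 0" using c e by simp
  ultimately have npos: "num > 0" by simp
  have d0: "\<delta> \<ge> 0"
  proof (rule ccontr)
    assume "\<not> ?thesis"
    then have "\<delta> * (1 - 2*u) \<le> 0" using u by (intro mult_nonpos_nonneg) auto
    then show False using npos u by (simp add: num_def)
  qed
  then show "\<mu> \<le> 1" by (simp add: \<delta>_def)
  show "c - 1 \<le> max ((1 - \<mu>)/2) ((1 - \<mu>) - 1/4)"
  proof (cases "\<delta> \<le> 1/2")
    case True
    have "\<delta>/2 * e - num = (1 - 3*u) * (1/4 - \<delta>/2) + \<delta>^2 * u / 2"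
      by (simp add: e num_def field_simps power2_eq_square)
    also have "\<dots> \<ge> 0" using True u by (intro add_nonneg_nonneg mult_nonneg_nonneg) auto
    finally have "(c - 1) * e \<le> \<delta>/2 * e" using n by simp
    then have "c - 1 \<le> \<delta>/2" using e by simp
    then show ?thesis unfolding \<delta>_def by (rule max.coboundedI1)
  next
    case False
    have "(\<delta> - 1/4) * e - num = u * (\<delta>^2 + 3*\<delta>/4 - 1/2)"
      by (simp add: e num_def field_simps power2_eq_square)
    also have "\<dots> \<ge> 0"
    proof -
      have "1/2 * (1/2) \<le> \<delta> * \<delta>" using False by (intro mult_mono) auto
      then show ?thesis using False u by (intro mult_nonneg_nonneg) (auto simp: power2_eq_square)
    qed
    finally have "(c - 1) * e \<le> (\<delta> - 1/4) * e" using n by simp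
    then have "c - 1 \<le> \<delta> - 1/4" using e by simp
    then show ?thesis unfolding \<delta>_def by (rule max.coboundedI2)
  qed
qed

section \<open>Sums of independent weighted indicators\<close>

text \<open>A list of pairs \<open>(b, p)\<close> stands for the sum of independent variables that take the value \<open>b\<close> with
probability \<open>p\<close> and the value \<open>0\<close> otherwise; \<open>prob_le xs t\<close> is the probability that the sum is at
most \<open>t\<close>.\<close>
fun prob_le :: "(real \<times> real) list \<Rightarrow> real \<Rightarrow> real" where
  "prob_le [] t = (if 0 \<le> t then 1 else 0)"
| "prob_le ((b, p) # xs) t = (1 - p) * prob_le xs t + p * prob_le xs (t - b)"

definition all_zero :: "(real \<times> real) list \<Rightarrow> real"
  where "all_zero xs = (\<Prod>(b, p)\<leftarrow>xs. 1 - p)"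

definition mean :: "(real \<times> real) list \<Rightarrow> real"
  where "mean xs = (\<Sum>(b, p)\<leftarrow>xs. b * p)"

definition jump_list :: "(real \<times> real) list \<Rightarrow> bool"
  where "jump_list xs \<longleftrightarrow> (\<forall>(b, p) \<in> set xs. 0 < b \<and> b \<le> 1 \<and> 0 \<le> p \<and> p \<le> 1)"

lemma all_zero_simps [simp]: "all_zero [] = 1" "all_zero ((b, p) # xs) = (1 - p) * all_zero xs"
  "all_zero (xs @ ys) = all_zero xs * all_zero ys"
  by (auto simp: all_zero_def)

lemma mean_simps [simp]: "mean [] = 0" "mean ((b, p) # xs) = b * p + mean xs"
  "mean (xs @ ys) = mean xs + mean ys"
  by (auto simp: mean_def)

lemma jump_list_simps [simp]: "jump_list []" "jump_list ((b, p) # xs) \<longleftrightarrow> 0 < b \<and> b \<le> 1 \<and> 0 \<le> p \<and> p \<le> 1 \<and> jump_list xs"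
  "jump_list (xs @ ys) \<longleftrightarrow> jump_list xs \<and> jump_list ys"
  by (auto simp: jump_list_def)

lemma all_zero_bounds: "jump_list xs \<Longrightarrow> 0 \<le> all_zero xs \<and> all_zero xs \<le> 1"
proof (induction xs)
  case (Cons a xs)
  obtain b p where a: "a = (b, p)" by fastforce
  have "(1 - p) * all_zero xs \<le> 1" using Cons by (intro mult_le_one) (auto simp: a)
  then show ?case using Cons by (auto simp: a)
qed simp

lemma mean_bounds: "jump_list xs \<Longrightarrow> 0 \<le> mean xs \<and> mean xs \<le> length xs"
proof (induction xs)
  case (Cons a xs)
  obtain b p where a: "a = (b, p)" by fastforce
  have "b * p \<le> 1" "0 \<le> b * p" using Cons(2) by (auto simp: a intro: mult_le_one)
  then show ?case using Cons by (auto simp: a)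
qed simp

lemma mean_le: "jump_list xs \<Longrightarrow> \<forall>(b, p) \<in> set xs. b \<le> z \<Longrightarrow> mean xs \<le> z * length xs"
proof (induction xs)
  case (Cons a xs)
  obtain b p where a: "a = (b, p)" by fastforce
  have "b * p \<le> b" using Cons(2) by (auto simp: a intro: mult_left_le)
  then have "b * p \<le> z" using Cons(3) by (auto simp: a)
  then show ?case using Cons by (auto simp: a algebra_simps)
qed simp

lemma prob_le_bounds: "\<forall>(b, p) \<in> set xs. 0 \<le> p \<and> p \<le> 1 \<Longrightarrow> 0 \<le> prob_le xs t \<and> prob_le xs t \<le> 1"
proof (induction xs arbitrary: t)
  case (Cons a xs)
  obtain b p where a: "a = (b, p)" by fastforce
  have p: "0 \<le> p" "p \<le> 1" using Cons(2) by (auto simp: a)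
  have IH: "0 \<le> prob_le xs s" "prob_le xs s \<le> 1" for s using Cons by auto
  have "(1 - p) * prob_le xs t + p * prob_le xs (t - b) \<le> (1 - p) * 1 + p * 1"
    using p IH by (intro add_mono mult_left_mono) auto
  then show ?case using p IH by (simp add: a)
qed simp

lemma jump_list_probs: "jump_list xs \<Longrightarrow> \<forall>(b, p) \<in> set xs. 0 \<le> p \<and> p \<le> 1"
  by (auto simp: jump_list_def)

lemma prob_le_neg: "jump_list xs \<Longrightarrow> t < 0 \<Longrightarrow> prob_le xs t = 0"
  by (induction xs arbitrary: t) auto

text \<open>If every jump exceeds \<open>t\<close>, then the sum is at most \<open>t\<close> only if there is no jump.\<close>
lemma prob_le_small:
  assumes "jump_list xs" "0 \<le> t" "\<forall>(b, p) \<in> set xs. t < b"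
  shows "prob_le xs t = all_zero xs"
  using assms by (induction xs) (auto simp: prob_le_neg)

lemma prob_le_zero: "jump_list xs \<Longrightarrow> prob_le xs 0 = all_zero xs"
  by (rule prob_le_small) (auto simp: jump_list_def)

lemma prob_le_ge_all_zero: "jump_list xs \<Longrightarrow> 0 \<le> t \<Longrightarrow> all_zero xs \<le> prob_le xs t"
proof (induction xs arbitrary: t)
  case (Cons a xs)
  obtain b p where a: "a = (b, p)" by fastforce
  have "(1 - p) * all_zero xs \<le> (1 - p) * prob_le xs t" using Cons by (auto simp: a intro: mult_left_mono)
  moreover have "0 \<le> p * prob_le xs (t - b)"
    using Cons(2) prob_le_bounds[OF jump_list_probs, of xs "t-b"] by (auto simp: a)
  ultimately show ?case by (simp add: a)
qed simp

lemma prob_le_move: "prob_le (xs @ x # ys) t = prob_le (x # xs @ ys) t"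
proof (induction xs arbitrary: t)
  case (Cons a xs)
  obtain b p where a: "a = (b, p)" by fastforce
  obtain b' p' where x: "x = (b', p')" by fastforce
  have "prob_le (xs @ (b', p') # ys) s = (1 - p') * prob_le (xs @ ys) s + p' * prob_le (xs @ ys) (s - b')" for s
    using Cons[of s] by (simp add: x)
  then show ?case by (simp only: a x append_Cons prob_le.simps) (simp add: algebra_simps)
qed simp

lemma prob_le_scale:
  assumes "k > 0"
  shows "prob_le (map (\<lambda>(b, p). (b / k, p)) xs) (t / k) = prob_le xs t"
proof (induction xs arbitrary: t)
  case (Cons a xs)
  obtain b p where a: "a = (b, p)" by fastforce
  have "prob_le (map (\<lambda>(b, p). (b / k, p)) xs) (t / k - b / k) = prob_le xs (t - b)"
    using Cons[of "t - b"] by (simp add: diff_divide_distrib)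
  then show ?case using Cons by (simp add: a)
qed (use assms in \<open>simp add: zero_le_divide_iff\<close>)

lemma mean_scale: "mean (map (\<lambda>(b, p). (b / k, p)) xs) = mean xs / k"
  by (induction xs) (auto simp: add_divide_distrib)

lemma all_zero_le_power:
  assumes "jump_list xs" "xs \<noteq> []"
  shows "all_zero xs \<le> (1 - mean xs / length xs) ^ length xs"
  using assms
proof (induction xs)
  case (Cons a xs)
  obtain b p where a: "a = (b, p)" by fastforce
  have v: "0 < b" "b \<le> 1" "0 \<le> p" "p \<le> 1" "jump_list xs" using Cons(2) by (auto simp: a)
  have bp: "b * p \<le> p" using v by (simp add: mult_left_le_one_le)
  then have bp1: "b * p \<le> 1" using v by simp
  show ?case
  proof (cases "xs = []")
    case True
    then show ?thesis using bp by (simp add: a)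
  next
    case False
    define N where "N = length xs"
    have N: "N > 0" using False by (simp add: N_def)
    have mm: "mean xs \<le> N" using mean_bounds[OF v(5)] by (simp add: N_def)
    have "all_zero (a # xs) \<le> (1 - b * p) * (1 - mean xs / N) ^ N"
      using Cons(1)[OF v(5) False] v bp bp1 all_zero_bounds[OF v(5)] by (auto simp: a N_def intro!: mult_mono)
    also have "\<dots> \<le> ((1 - b * p + real N * (1 - mean xs / N)) / real (N+1)) ^ (N+1)"
      using bp1 mm N by (intro amgm_power) auto
    also have "(1 - b * p + real N * (1 - mean xs / N)) / real (N+1) = 1 - mean (a # xs) / real (N+1)"
    proof -
      have "real N * (1 - mean xs / N) = N - mean xs" using N by (simp add: right_diff_distrib)
      then show ?thesis by (simp add: a diff_divide_distrib add_divide_distrib) (simp add: field_simps)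
    qed
    finally show ?thesis by (simp add: N_def)
  qed
qed simp

section \<open>Induction on the number of summands\<close>

definition boosted :: "real \<Rightarrow> (real \<times> real) list \<Rightarrow> real"
  where "boosted c xs = prob_le xs 1 + c * all_zero xs"

lemma boosted_move: "boosted c (xs @ x # ys) = boosted c (x # xs @ ys)"
  by (cases x) (simp add: boosted_def prob_le_move)

text \<open>The weight \<open>c\<close> is universally quantified, since the induction step for a summand with jump \<open>1\<close>
changes it.\<close>
definition bound_holds :: "nat \<Rightarrow> bool" where
  "bound_holds N \<longleftrightarrow> (\<forall>xs c. length xs = N \<longrightarrow> jump_list xs \<longrightarrow> c \<ge> 0 \<longrightarrow> boosted c xs \<le> extremal_bound N c (mean xs))"

lemma unit_step:
  assumes IH: "bound_holds N" and ys: "length ys = N" "jump_list ys" "N \<ge> 1"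
    and p: "0 \<le> p" "p \<le> 1" and c: "c \<ge> 0"
  shows "boosted c ((1, p) # ys) \<le> extremal_bound (N+1) c (mean ys + p)"
proof (cases "p = 1")
  case True
  have mm: "0 \<le> mean ys" "mean ys \<le> N" using mean_bounds[OF ys(2)] ys(1) by auto
  have "boosted c ((1, p) # ys) = all_zero ys"
    using True by (simp add: boosted_def prob_le_zero ys)
  also have "\<dots> \<le> (1 - mean ys / N) ^ N" 
  proof -
    have "ys \<noteq> []" using ys by auto
    then show ?thesis using all_zero_le_power[OF ys(2)] ys by simp
  qed
  also have "\<dots> = pinned_prob (N+1) (mean ys + p)"
    using ys(3) True by (subst pinned_prob_eq) (auto simp: field_simps)
  also have "\<dots> \<le> extremal_bound (N+1) c (mean ys + p)"
    using mm True ys(3) by (subst extremal_bound_eq) (auto simp: pinned_prob_def)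
  finally show ?thesis .
next
  case False
  with p have p1: "p < 1" by simp
  have mm: "0 \<le> mean ys" "mean ys \<le> N" using mean_bounds[OF ys(2)] ys(1) by auto
  have "boosted c ((1, p) # ys) = (1 - p) * boosted (c + p / (1-p)) ys"
  proof -
    have "(1 - p) * (p / (1-p) * all_zero ys) = p * all_zero ys" using p1 by simp
    then show ?thesis by (simp add: boosted_def prob_le_zero ys algebra_simps)
  qed
  also have "\<dots> \<le> (1 - p) * extremal_bound N (c + p / (1-p)) (mean ys)"
    using IH ys p1 p c unfolding bound_holds_def by (intro mult_left_mono) auto
  also have "\<dots> \<le> extremal_bound (N+1) c (mean ys + p)"
    by (rule extremal_bound_unit) (use ys mm p p1 c in auto)
  finally show ?thesis .
qed

text \<open>The chord condition compares the law on \<open>{0, b}\<close> with the law on \<open>{0, 1}\<close> that has the same mean: the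
value at \<open>b\<close> lies below the chord through the values at \<open>0\<close> and \<open>1\<close>, so the second law is at
least as good.\<close>
lemma convert_to_unit:
  assumes "bound_holds N" "length ys = N" "jump_list ys" "N \<ge> 1"
    and b: "0 < b" "b \<le> 1" "0 \<le> p" "p \<le> 1" and c: "c \<ge> 0"
    and chord: "b * (prob_le ys (1 - b) - all_zero ys) \<le> (1 - b) * (prob_le ys 1 - prob_le ys (1 - b) + c * all_zero ys)"
  shows "boosted c ((b, p) # ys) \<le> extremal_bound (N+1) c (mean ((b, p) # ys))"
proof -
  have bp: "0 \<le> b * p" "b * p \<le> 1" using b by (auto intro: mult_le_one)
  have "boosted c ((1, b * p) # ys) - boosted c ((b, p) # ys) =
     p * ((1 - b) * (prob_le ys 1 - prob_le ys (1 - b) + c * all_zero ys) - b * (prob_le ys (1 - b) - all_zero ys))"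
    using assms(3) by (simp add: boosted_def prob_le_zero) (simp add: algebra_simps)
  also have "\<dots> \<ge> 0" using b chord by (intro mult_nonneg_nonneg) auto
  finally have "boosted c ((b, p) # ys) \<le> boosted c ((1, b * p) # ys)" by simp
  also have "\<dots> \<le> extremal_bound (N+1) c (mean ys + b * p)" by (rule unit_step) (use assms bp in auto)
  finally show ?thesis by (simp add: add.commute)
qed

text \<open>As a function of \<open>c\<close>, the bound is constant up to the value \<open>c0\<close> at which the extremal
configurations tie (if this is positive), and then affine with slope \<open>(1 - \<mu>/m) ^ m\<close>, which dominates
the slope \<open>g\<close>. Hence the case \<open>c = c0\<close> implies all others.\<close>
lemma slope_reduction:
  assumes m: "m = N + 1" and mu: "\<mu> < real m"
    and c0: "c0 = max ((pinning_factor m - \<mu>) / (1 - \<mu> / m) - 1) 0"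
    and g: "0 \<le> g" "g \<le> (1 - \<mu> / m) ^ m"
    and base: "P + c0 * g \<le> extremal_bound m c0 \<mu>" and c: "c \<ge> 0"
  shows "P + c * g \<le> extremal_bound m c \<mu>"
proof -
  define e where "e = 1 - \<mu> / m"
  have e: "e > 0" using mu m by (simp add: e_def field_simps)
  define L where "L = (\<lambda>c. (1 + c) * e + \<mu>)"
  have Lc0: "pinning_factor m \<le> L c0"
  proof -
    have "(pinning_factor m - \<mu>) / e \<le> 1 + c0" unfolding c0 e_def by simp
    then have "pinning_factor m - \<mu> \<le> (1 + c0) * e" using e by (simp add: divide_le_eq)
    then show ?thesis by (simp add: L_def)
  qed
  have B: "extremal_bound m c \<mu> = e ^ N * max (pinning_factor m) (L c)" for c by (simp add: extremal_bound_def e_def L_def m)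
  show ?thesis
  proof (cases "c \<le> c0")
    case True
    have "P + c * g \<le> P + c0 * g" using True g by (simp add: mult_right_mono)
    also have "\<dots> \<le> extremal_bound m c0 \<mu>" by (rule base)
    also have "\<dots> \<le> extremal_bound m c \<mu>"
    proof (cases "c0 = 0")
      case True
      then show ?thesis using \<open>c \<le> c0\<close> c by simp
    next
      case False
      then have "1 + c0 = (pinning_factor m - \<mu>) / e" unfolding c0 e_def by (auto simp: max_def split: if_splits)
      then have "L c0 = pinning_factor m" using e by (simp add: L_def)
      then have "extremal_bound m c0 \<mu> = e ^ N * pinning_factor m" by (simp add: B)
      also have "\<dots> \<le> extremal_bound m c \<mu>" unfolding B using e by (intro mult_left_mono) auto
      finally show ?thesis .
    qed
    finally show ?thesis .
  next
    case False
    have "P + c * g = (P + c0 * g) + (c - c0) * g" by (simp add: algebra_simps)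
    also have "\<dots> \<le> e ^ N * L c0 + (c - c0) * e ^ m"
      using base g False Lc0 by (intro add_mono mult_left_mono) (auto simp: B e_def)
    also have "\<dots> = e ^ N * L c" by (simp add: m L_def algebra_simps)
    also have "\<dots> \<le> extremal_bound m c \<mu>" unfolding B using e by (intro mult_left_mono) auto
    finally show ?thesis .
  qed
qed

text \<open>Write \<open>R\<close> for the sum given by \<open>ys\<close>. Unless \<open>\<beta>\<close> can be replaced by \<open>1\<close>, the value lies above the chord,
and this bounds the whole expression by \<open>(s/z) P(R \<le> z)\<close>. Since all jumps in \<open>ys\<close> are at most \<open>z\<close>, the
induction hypothesis applies to \<open>R/z\<close>, which has mean \<open>\<nu> = r/z\<close>. On the other side, a
unit jump with probability \<open>\<beta> \<theta>\<close> shows that the target is at least \<open>s\<close> times the bound for mean \<open>r\<close>.\<close>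
lemma small_step:
  assumes IH: "bound_holds N" and ys: "length ys = N" "jump_list ys" "N \<ge> 1"
    and b: "0 < \<beta>" "\<beta> \<le> 1/2" "0 \<le> \<theta>" "\<theta> \<le> 1" and c: "c \<ge> 0"
    and small: "\<forall>(b, p) \<in> set ys. b \<le> 1 - \<beta>"
  shows "boosted c ((\<beta>, \<theta>) # ys) \<le> extremal_bound (N+1) c (mean ((\<beta>, \<theta>) # ys))"
proof -
  define m z r \<nu> \<mu> s y where "m = N + 1" and "z = 1 - \<beta>" and "r = mean ys" and "\<nu> = r / z"
    and "\<mu> = \<beta> * \<theta> + r" and "s = 1 - \<beta> * \<theta>" and "y = \<beta> * (1 - \<theta>)"
  have z: "1/2 \<le> z" "z < 1" "z > 0" using b by (auto simp: z_def)
  have bt: "0 \<le> \<beta> * \<theta>" "\<beta> * \<theta> \<le> 1/2"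
    using mult_mono[of \<beta> "1/2" \<theta> 1] b by auto
  have y: "0 \<le> y" and s: "s = z + y" "1/2 \<le> s" "s \<le> 1"
    using b bt by (auto simp: y_def s_def z_def algebra_simps)
  have r0: "0 \<le> r" using mean_bounds[OF ys(2)] by (simp add: r_def)
  have rz: "r \<le> z * N" using mean_le[OF ys(2), of z] small ys(1) by (simp add: r_def z_def)
  have nu: "0 \<le> \<nu>" "\<nu> \<le> real N" "r = z * \<nu>"
    using r0 rz z by (auto simp: \<nu>_def field_simps)
  have rN: "r \<le> real N" using rz z mult_right_mono[of z 1 "real N"] by simp
  have mu: "0 \<le> \<mu>" "\<mu> < real m" using r0 rN bt by (auto simp: \<mu>_def m_def)
  define q A where "q = all_zero ys" and "A = prob_le ys z"
  have q: "0 \<le> q" "q \<le> 1" using all_zero_bounds[OF ys(2)] by (auto simp: q_def)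
  have P1: "prob_le ys t \<le> 1" for t using prob_le_bounds[OF jump_list_probs[OF ys(2)]] by blast
  have A1: "A \<le> 1" unfolding A_def by (rule P1)
  have xs_jumps: "jump_list ((\<beta>, \<theta>) # ys)" using b ys by simp
  define c0 where "c0 = max ((pinning_factor m - \<mu>) / (1 - \<mu> / m) - 1) 0"
  have c00: "c0 \<ge> 0" by (simp add: c0_def)
  have mean_mu: "mean ((\<beta>, \<theta>) # ys) = \<mu>" by (simp add: \<mu>_def r_def)
  \<comment> \<open>the induction hypothesis for \<open>R/z\<close> with weight \<open>0\<close>\<close>
  have AB: "A \<le> extremal_bound N 0 \<nu>"
  proof -
    define zs where "zs = map (\<lambda>(b, p). (b / z, p)) ys"
    have "jump_list zs" using ys(2) small z by (fastforce simp: zs_def jump_list_def z_def divide_le_eq)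
    moreover have "length zs = N" by (simp add: zs_def ys)
    ultimately have "boosted 0 zs \<le> extremal_bound N 0 (mean zs)" using IH unfolding bound_holds_def by blast
    moreover have "boosted 0 zs = A"
      using prob_le_scale[OF z(3), of ys z] z by (simp add: boosted_def zs_def A_def)
    ultimately show ?thesis by (simp add: zs_def mean_scale \<nu>_def r_def)
  qed
  have B_s: "s * extremal_bound N 0 r \<le> extremal_bound m c0 \<mu>"
  proof -
    have "s * extremal_bound N 0 r \<le> s * extremal_bound N (0 + \<beta> * \<theta> / (1 - \<beta> * \<theta>)) r"
      using ys s bt rN by (intro mult_left_mono extremal_bound_mono_c) auto
    also have "\<dots> \<le> extremal_bound (N+1) 0 (r + \<beta> * \<theta>)"
      unfolding s_def using ys bt r0 rN by (intro extremal_bound_unit) auto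
    also have "\<dots> = extremal_bound m 0 \<mu>" by (simp add: m_def \<mu>_def add.commute)
    also have "\<dots> \<le> extremal_bound m c0 \<mu>" using mu c00 by (intro extremal_bound_mono_c) (auto simp: m_def)
    finally show ?thesis .
  qed
  have main: "boosted c0 ((\<beta>, \<theta>) # ys) \<le> extremal_bound m c0 \<mu>"
  \<comment> \<open>the chord condition\<close>
  proof (cases "\<beta> * (A - q) \<le> z * (prob_le ys 1 - A + c0 * q)")
    case True
    then show ?thesis
      using convert_to_unit[OF IH ys(1,2,3) b(1) _ b(3,4) c00] b
      by (simp add: A_def q_def z_def m_def mean_mu[symmetric])
  next
    case False
    define G where "G = boosted c0 ((\<beta>, \<theta>) # ys)"
    define H where "H = prob_le ys 1 - A + c0 * q"
    have G: "G = A + (1 - \<theta>) * H"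
      by (simp add: G_def boosted_def H_def A_def q_def z_def algebra_simps)
    have M1: "z * G \<le> s * A - y * q"
    proof -
      have "z * G = z * A + (1 - \<theta>) * (z * H)" by (simp add: G algebra_simps)
      also have "\<dots> \<le> z * A + (1 - \<theta>) * (\<beta> * (A - q))"
        using False b by (intro add_left_mono mult_left_mono) (auto simp: H_def)
      also have "\<dots> = s * A - y * q" by (simp add: s y_def algebra_simps)
      finally show ?thesis .
    qed
    have M2: "G \<le> \<theta> * A + (1 - \<theta>) * (1 + c0 * q)"
    proof -
      have "(1 - \<theta>) * H \<le> (1 - \<theta>) * (1 - A + c0 * q)"
        using P1[of 1] b by (intro mult_left_mono) (auto simp: H_def)
      then show ?thesis by (simp add: G algebra_simps)
    qed
    \<comment> \<open>the chord bound suffices when rescaling costs at most the factor \<open>z\<close>\<close>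
    have big: "G \<le> extremal_bound m c0 \<mu>" if "A \<le> z * extremal_bound N 0 r"
    proof -
      have "z * G \<le> s * A" using M1 mult_nonneg_nonneg[OF y q(1)] by linarith
      also have "\<dots> \<le> s * (z * extremal_bound N 0 r)" using that s by (intro mult_left_mono) auto
      also have "\<dots> = z * (s * extremal_bound N 0 r)" by simp
      also have "\<dots> \<le> z * extremal_bound m c0 \<mu>" using B_s z by (intro mult_left_mono) auto
      finally show ?thesis using z by simp
    qed
    have nuA: "A \<le> z * extremal_bound N 0 r" if "\<nu> * extremal_bound N 0 \<nu> \<le> r * extremal_bound N 0 r" "\<nu> > 0"
    proof -
      have "\<nu> * A \<le> \<nu> * extremal_bound N 0 \<nu>" using AB nu by (intro mult_left_mono) auto
      also have "\<dots> \<le> \<nu> * (z * extremal_bound N 0 r)" using that(1) by (simp add: nu(3) mult_ac)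
      finally show ?thesis using that(2) by simp
    qed
    have r_le_nu: "r \<le> \<nu>" using nu z by (simp add: mult_left_le_one_le)
    consider "1 \<le> r" | "r < 1" "3/2 \<le> \<nu>" | "r < 1" "\<nu> \<le> 3/2" by linarith
    then have "G \<le> extremal_bound m c0 \<mu>"
    proof cases
      case 1
      have "N \<ge> 2"
      proof (rule ccontr)
        assume "\<not> N \<ge> 2"
        then have "N = 1" using ys by simp
        then show False using 1 rz z by simp
      qed
      then have "\<nu> * extremal_bound N 0 \<nu> \<le> r * extremal_bound N 0 r" using 1 r_le_nu nu by (intro extremal_bound_mean_decr) auto
      then show ?thesis using 1 r_le_nu by (intro big nuA) auto
    next
      case 2
      then have N2: "N \<ge> 2" using nu(2) by (cases "N \<le> 1") auto
      \<comment> \<open>down to \<open>3/2\<close> by monotonicity, across the maximum at \<open>1\<close> to \<open>3/4\<close>, and up to \<open>r\<close>\<close>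
      have "\<nu> * extremal_bound N 0 \<nu> \<le> 3/2 * extremal_bound N 0 (3/2)" using 2 nu N2 by (intro extremal_bound_mean_decr) auto
      also have "\<dots> = 3/4 * (2 * pinned_prob N (3/2))" using N2 by (subst extremal_bound_eq_pinned) auto
      also have "\<dots> \<le> 3/4 * pinned_prob N (3/4)" using pinned_prob_double[OF N2] by simp
      also have "\<dots> \<le> r * pinned_prob N r"
      proof (rule pinned_prob_incr[OF N2])
        show "3/4 \<le> r" using mult_mono[of "1/2" z "3/2" \<nu>] 2 z nu(3) by simp
      qed (use 2 in simp)
      also have "\<dots> = r * extremal_bound N 0 r" using 2 N2 by (subst extremal_bound_eq_pinned) auto
      finally show ?thesis using 2 by (intro big nuA) auto
    next
      case 3
      \<comment> \<open>written in this form to match the inequality for the window, with \<open>x = \<nu> - 1\<close>\<close>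
      define \<delta> where "\<delta> = s - z * (1 + (\<nu> - 1))"
      have delta: "\<delta> = 1 - \<mu>" by (simp add: \<delta>_def s_def \<mu>_def nu(3))
      have w: "pinned_prob m \<mu> \<le> extremal_bound m c0 \<mu>"
        using mu by (subst extremal_bound_eq) (auto simp: m_def pinned_prob_def)
      have "G \<le> pinned_prob m \<mu>"
      proof (rule window_ineq[of \<beta> \<theta> z s y \<delta> "\<nu> - 1" A q c0 G "pinned_prob m \<mu>"])
        show "0 < \<beta>" "\<beta> \<le> 1/2" "0 \<le> \<theta>" "\<theta> \<le> 1" by fact+
        show "z = 1 - \<beta>" "s = 1 - \<beta> * \<theta>" "y = \<beta> * (1 - \<theta>)" "\<delta> = s - z * (1 + (\<nu> - 1))"
          by (fact z_def s_def y_def \<delta>_def)+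
        show "z * (1 + (\<nu> - 1)) \<le> 1" using 3 nu by simp
        show "A \<le> 1" by (rule A1)
        show "A \<le> 1 - (\<nu> - 1) + (\<nu> - 1)\<^sup>2/2" if "0 \<le> \<nu> - 1"
        proof (cases "N \<ge> 2")
          case True
          have "A \<le> pinned_prob N (1 + (\<nu> - 1))" using AB 3 by (simp add: extremal_bound_eq_pinned[OF True])
          also have "\<dots> \<le> 1 - (\<nu> - 1) + (\<nu> - 1)\<^sup>2/2" using that 3 by (intro pinned_prob_le_quadratic True) auto
          finally show ?thesis .
        next
          case False
          then have "\<nu> = 1" using nu that ys by simp
          then show ?thesis using A1 by simp
        qed
        show "0 \<le> q" by (rule q)
        show "0 \<le> c0" by (rule c00)
        show "z * G \<le> s * A - y * q" by (rule M1)
        show "G \<le> \<theta> * A + (1 - \<theta>) * (1 + c0 * q)" by (rule M2)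
        show "1 + \<delta> \<le> pinned_prob m \<mu>" unfolding delta m_def using mu ys by (intro pinned_prob_ge) (auto simp: m_def)
        assume c1: "1 < c0"
        then have cc: "c0 = (pinning_factor m - \<mu>) / (1 - \<mu> / m) - 1" by (auto simp: c0_def max_def split: if_splits)
        have N2: "N \<ge> 2"
        proof (rule ccontr)
          assume "\<not> N \<ge> 2"
          then have "m = 2" using ys by (simp add: m_def)
          then have "c0 = (2 - \<mu>) / (1 - \<mu> / 2) - 1" unfolding cc by (simp add: pinning_factor_def)
          also have "\<dots> = 1" using mu \<open>m = 2\<close> by (simp add: field_simps)
          finally show False using c1 by simp
        qed
        then have m3: "m \<ge> 3" by (simp add: m_def)
        note C = critical_c_bound[OF m3 mu cc c1]
        show "0 \<le> \<delta> \<and> 1 + \<delta> + \<delta>\<^sup>2/4 \<le> pinned_prob m \<mu> \<and> c0 - 1 \<le> max (\<delta>/2) (\<delta> - 1/4)"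
          unfolding delta using C pinned_prob_ge(2)[OF ys(3) _ N2 C(1)] mu by (simp add: m_def)
      qed
      then show ?thesis using w by simp
    qed
    then show ?thesis by (simp add: G_def)
  qed
  have az: "all_zero ((\<beta>, \<theta>) # ys) \<le> (1 - \<mu> / m) ^ m"
    using all_zero_le_power[OF xs_jumps] ys(1) unfolding mean_mu by (simp add: m_def add.commute)
  show ?thesis unfolding mean_mu boosted_def m_def[symmetric]
  proof (rule slope_reduction[OF m_def mu(2) c0_def _ az _ c])
    show "0 \<le> all_zero ((\<beta>, \<theta>) # ys)" using all_zero_bounds[OF xs_jumps] by simp
  qed (use main in \<open>simp add: boosted_def\<close>)
qed

text \<open>The least jump \<open>\<beta>\<close> is treated by \<open>small_step\<close>, provided that no jump exceeds \<open>1 - \<beta>\<close>. A larger jump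
(possibly \<open>\<beta>\<close> itself) excludes all other jumps, so it satisfies the chord condition.\<close>
theorem bound_holds_all: "N \<ge> 1 \<Longrightarrow> bound_holds N"
proof (induction N rule: nat_induct_at_least)
  case base
  show ?case unfolding bound_holds_def
  proof (intro allI impI)
    fix xs :: "(real \<times> real) list" and c :: real
    assume xs: "length xs = 1" "jump_list xs" "c \<ge> 0"
    then obtain b p where bp: "xs = [(b, p)]" by (cases xs) (auto simp: length_Suc_conv)
    have v: "0 < b" "b \<le> 1" "0 \<le> p" "p \<le> 1" using xs(2) by (auto simp: bp)
    have "b * p \<le> p" using v by (simp add: mult_left_le_one_le)
    then have "c * (1 - p) \<le> c * (1 - b * p)" using xs by (intro mult_left_mono) auto
    then show "boosted c xs \<le> extremal_bound 1 c (mean xs)"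
      using v by (simp add: bp boosted_def extremal_bound_def algebra_simps)
  qed
next
  case (Suc N)
  show ?case unfolding bound_holds_def
  proof (intro allI impI)
    fix xs :: "(real \<times> real) list" and c :: real
    assume xs: "length xs = Suc N" "jump_list xs" "c \<ge> 0"
    have split: "boosted c xs \<le> extremal_bound (Suc N) c (mean xs)"
      if "(b, p) \<in> set xs" and step: "\<And>ys. set ys \<subseteq> set xs \<Longrightarrow> set xs \<subseteq> insert (b, p) (set ys) \<Longrightarrow> length ys = N \<Longrightarrow> jump_list ys \<Longrightarrow>
        boosted c ((b, p) # ys) \<le> extremal_bound (N+1) c (mean ((b, p) # ys))" for b p
    proof -
      from that(1) obtain us vs where u: "xs = us @ (b, p) # vs" by (metis split_list)
      have "boosted c ((b, p) # us @ vs) \<le> extremal_bound (N+1) c (mean ((b, p) # us @ vs))"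
        by (rule step) (use u xs in auto)
      moreover have "mean ((b, p) # us @ vs) = mean xs" by (simp add: u add.left_commute)
      ultimately show ?thesis by (simp add: u boosted_move add.left_commute)
    qed
    have vx: "0 < b" "b \<le> 1" "0 \<le> p" "p \<le> 1" if "(b, p) \<in> set xs" for b p
      using xs(2) that by (auto simp: jump_list_def)
    define \<beta> where "\<beta> = Min (fst ` set xs)"
    have ne: "set xs \<noteq> {}" using xs(1) by auto
    have "\<beta> \<in> fst ` set xs" unfolding \<beta>_def using ne by (intro Min_in) auto
    then obtain \<theta> where th: "(\<beta>, \<theta>) \<in> set xs" by auto
    have least: "\<beta> \<le> b" if "(b, p) \<in> set xs" for b p
      unfolding \<beta>_def using that by (intro Min_le) force+
    show "boosted c xs \<le> extremal_bound (Suc N) c (mean xs)"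
    proof (cases "\<exists>b p. (b, p) \<in> set xs \<and> b > 1 - \<beta>")
      case True
      then obtain b p where bp: "(b, p) \<in> set xs" "b > 1 - \<beta>" by blast
      show ?thesis
      proof (rule split[OF bp(1)])
        fix ys assume ys: "set ys \<subseteq> set xs" "length ys = N" "jump_list ys"
        have eq: "prob_le ys (1 - b) = all_zero ys"
        proof (rule prob_le_small[OF ys(3)])
          show "\<forall>(b', p') \<in> set ys. 1 - b < b'"
            using least ys(1) bp(2) by fastforce
        qed (use vx[OF bp(1)] in simp)
        show "boosted c ((b, p) # ys) \<le> extremal_bound (N+1) c (mean ((b, p) # ys))"
        proof (rule convert_to_unit[OF Suc.IH ys(2,3) Suc.hyps vx[OF bp(1)] xs(3)])
          have "all_zero ys \<le> prob_le ys 1" using ys by (intro prob_le_ge_all_zero) auto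
          then show "b * (prob_le ys (1 - b) - all_zero ys)
             \<le> (1 - b) * (prob_le ys 1 - prob_le ys (1 - b) + c * all_zero ys)"
            unfolding eq using vx[OF bp(1)] xs(3) all_zero_bounds[OF ys(3)]
            by (simp add: mult_nonneg_nonneg)
        qed
      qed
    next
      case False
      then have small: "b \<le> 1 - \<beta>" if "(b, p) \<in> set xs" for b p using that by force
      show ?thesis
      proof (rule split[OF th])
        fix ys assume ys: "set ys \<subseteq> set xs" "length ys = N" "jump_list ys"
        show "boosted c ((\<beta>, \<theta>) # ys) \<le> extremal_bound (N+1) c (mean ((\<beta>, \<theta>) # ys))"
        proof (rule small_step[OF Suc.IH ys(2,3) Suc.hyps _ _ _ _ xs(3)])
          show "\<beta> \<le> 1/2" using small[OF th] by simp
          show "\<forall>(b, p) \<in> set ys. b \<le> 1 - \<beta>" using small ys(1) by fast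
        qed (use vx[OF th] in auto)
      qed
    qed
  qed
qed

section \<open>From two-point laws to weighted indicators\<close>

lemma prob_le_mono: "\<forall>(b, p) \<in> set xs. 0 \<le> p \<and> p \<le> 1 \<Longrightarrow> s \<le> t \<Longrightarrow> prob_le xs s \<le> prob_le xs t"
proof (induction xs arbitrary: s t)
  case (Cons a xs)
  obtain b p where a: "a = (b, p)" by fastforce
  show ?case using Cons by (auto simp: a intro!: add_mono mult_left_mono)
qed simp

lemma prob_le_thin:
  assumes "jump_list xs" "0 \<le> k" "k \<le> 1"
  shows "prob_le xs t \<le> prob_le (map (\<lambda>(b, p). (b, k * p)) xs) t"
  using assms(1)
proof (induction xs arbitrary: t)
  case (Cons a xs)
  obtain b p where a: "a = (b, p)" by fastforce
  have v: "0 < b" "0 \<le> p" "p \<le> 1" "jump_list xs" using Cons(2) by (auto simp: a)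
  have kp: "k * p \<le> p" using v assms by (simp add: mult_left_le_one_le)
  let ?ys = "map (\<lambda>(b, p). (b, k * p)) xs"
  have "prob_le xs (t - b) \<le> prob_le xs t" using v by (intro prob_le_mono jump_list_probs) auto
  then have "(p - k * p) * prob_le xs (t - b) \<le> (p - k * p) * prob_le xs t"
    using kp by (intro mult_left_mono) auto
  then have "prob_le (a # xs) t \<le> (1 - k * p) * prob_le xs t + k * p * prob_le xs (t - b)"
    by (simp add: a algebra_simps)
  also have "\<dots> \<le> (1 - k * p) * prob_le ?ys t + k * p * prob_le ?ys (t - b)"
    using Cons(1)[OF v(4)] v kp assms by (intro add_mono mult_left_mono) auto
  finally show ?case by (simp add: a)
qed simp

text \<open>Multiplying all jump probabilities by \<open>lam / mean xs\<close> does not decrease the probability, and then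
the mean is exactly \<open>lam\<close>.\<close>
lemma prob_le_extremal_bound:
  assumes xs: "jump_list xs" "xs \<noteq> []" and lam: "0 \<le> lam" "lam \<le> mean xs"
  shows "prob_le xs 1 \<le> extremal_bound (length xs) 0 lam"
proof -
  \<comment> \<open>if the mean vanishes, then so does \<open>lam\<close>, and \<open>k = 0\<close> is as good as any other factor\<close>
  define k where "k = (if mean xs = 0 then 0 else lam / mean xs)"
  have k: "0 \<le> k" "k \<le> 1" "k * mean xs = lam" using lam by (auto simp: k_def divide_le_eq)
  let ?ys = "map (\<lambda>(b, p). (b, k * p)) xs"
  have "jump_list ?ys" using xs(1) k by (fastforce simp: jump_list_def intro: mult_le_one)
  moreover have "mean ?ys = k * mean xs" by (induction xs) (auto simp: algebra_simps)
  moreover have "bound_holds (length xs)" using xs by (intro bound_holds_all) (simp add: Suc_le_eq)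
  ultimately have "boosted 0 ?ys \<le> extremal_bound (length xs) 0 lam"
    using k unfolding bound_holds_def by (metis length_map order_refl)
  moreover have "prob_le xs 1 \<le> prob_le ?ys 1" by (rule prob_le_thin) fact+
  ultimately show ?thesis by (simp add: boosted_def)
qed

text \<open>For the configuration with one summand pinned at \<open>1\<close>: jumps larger than the room \<open>\<delta>\<close> become unit
jumps, and the other summands vanish.\<close>
definition blocked :: "real \<Rightarrow> real \<times> real \<Rightarrow> real \<times> real" where
  "blocked \<delta> = (\<lambda>(d, p). (1, if d > \<delta> then p else 0))"

text \<open>The room \<open>\<delta>\<close> is stretched to \<open>1\<close>: jumps that do not fit become unit jumps, the others are divided by
\<open>\<delta>\<close>. A jump of size \<open>0\<close> is encoded with probability \<open>0\<close>, since jumps have to be positive.\<close>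
definition rescaled :: "real \<Rightarrow> real \<times> real \<Rightarrow> real \<times> real" where
  "rescaled \<delta> = (\<lambda>(d, p). if d > \<delta> then (1, p) else if d = 0 then (1, 0) else (d / \<delta>, p))"

definition small_mean :: "real \<Rightarrow> (real \<times> real) list \<Rightarrow> real" where
  "small_mean \<delta> ds = (\<Sum>(d, p)\<leftarrow>ds. if d > \<delta> then 0 else d * p)"

abbreviation step_list :: "(real \<times> real) list \<Rightarrow> bool" where
  "step_list ds \<equiv> \<forall>(d, p) \<in> set ds. 0 \<le> d \<and> d \<le> 1 \<and> 0 \<le> p \<and> p \<le> 1"

lemma prob_le_neg_step_list: "step_list ds \<Longrightarrow> t < 0 \<Longrightarrow> prob_le ds t = 0"
  by (induction ds arbitrary: t) auto

lemma jump_list_blocked: "step_list ds \<Longrightarrow> jump_list (map (blocked \<delta>) ds)"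
  by (auto simp: jump_list_def blocked_def)

lemma prob_le_blocked:
  assumes "step_list ds" "t \<le> \<delta>"
  shows "prob_le ds t \<le> all_zero (map (blocked \<delta>) ds)"
  using assms
proof (induction ds arbitrary: t)
  case (Cons a ds)
  obtain d p where a: "a = (d, p)" by fastforce
  have v: "0 \<le> d" "0 \<le> p" "p \<le> 1" "step_list ds" using Cons(2) by (auto simp: a)
  have IH: "prob_le ds s \<le> all_zero (map (blocked \<delta>) ds)" if "s \<le> \<delta>" for s
    using Cons(1)[OF v(4) that] .
  show ?case
  proof (cases "d > \<delta>")
    case True
    then have "prob_le ds (t - d) = 0" using Cons(3) by (intro prob_le_neg_step_list v) auto
    then show ?thesis using True IH[OF Cons(3)] v by (simp add: a blocked_def mult_left_mono)
  next
    case False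
    have "(1 - p) * prob_le ds t + p * prob_le ds (t - d)
       \<le> (1 - p) * all_zero (map (blocked \<delta>) ds) + p * all_zero (map (blocked \<delta>) ds)"
      using Cons(3) v by (intro add_mono mult_left_mono IH) auto
    also have "\<dots> = all_zero (map (blocked \<delta>) ds)" by (simp add: algebra_simps)
    finally show ?thesis using False by (simp add: a blocked_def)
  qed
qed simp

lemma prob_le_rescaled:
  assumes "step_list ds" "t \<le> 1" "\<delta> > 0"
  shows "prob_le ds (\<delta> * t) \<le> prob_le (map (rescaled \<delta>) ds) t"
  using assms(1,2)
proof (induction ds arbitrary: t)
  case Nil
  then show ?case using assms(3) by (simp add: zero_le_mult_iff)
next
  case (Cons a ds)
  obtain d p where a: "a = (d, p)" by fastforce
  have v: "0 \<le> d" "0 \<le> p" "p \<le> 1" "step_list ds" using Cons(2) by (auto simp: a)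
  have IH: "prob_le ds (\<delta> * s) \<le> prob_le (map (rescaled \<delta>) ds) s" if "s \<le> 1" for s
    using Cons(1)[OF v(4) that] .
  have pr: "\<forall>(b, p) \<in> set (map (rescaled \<delta>) ds). 0 \<le> p \<and> p \<le> 1"
    using v(4) by (fastforce simp: rescaled_def split: if_splits)
  consider "d > \<delta>" | "d \<le> \<delta>" "d = 0" | "d \<le> \<delta>" "d > 0" using v by linarith
  then show ?case
  proof cases
    case 1
    have "\<delta> * t \<le> \<delta> * 1" using Cons(3) assms(3) by (intro mult_left_mono) auto
    then have "prob_le ds (\<delta> * t - d) = 0" using 1 by (intro prob_le_neg_step_list v) auto
    moreover have "0 \<le> p * prob_le (map (rescaled \<delta>) ds) (t - 1)"
      using v prob_le_bounds[OF pr] by (intro mult_nonneg_nonneg) auto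
    moreover have "(1 - p) * prob_le ds (\<delta> * t) \<le> (1 - p) * prob_le (map (rescaled \<delta>) ds) t"
      using IH[OF Cons(3)] v by (intro mult_left_mono) auto
    moreover have "rescaled \<delta> a = (1, p)" using 1 by (simp add: a rescaled_def)
    ultimately show ?thesis by (simp add: a)
  next
    case 2
    then show ?thesis using IH[OF Cons(3)] by (simp add: a rescaled_def algebra_simps)
  next
    case 3
    have r: "rescaled \<delta> a = (d / \<delta>, p)" using 3 by (simp add: a rescaled_def)
    have "\<delta> * (t - d / \<delta>) = \<delta> * t - d" using assms(3) by (simp add: right_diff_distrib)
    moreover have "t - d / \<delta> \<le> 1" using Cons(3) v assms(3) by (simp add: add_increasing2 algebra_simps)
    ultimately have "prob_le ds (\<delta> * t - d) \<le> prob_le (map (rescaled \<delta>) ds) (t - d / \<delta>)"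
      using IH[of "t - d / \<delta>"] by simp
    then have "(1 - p) * prob_le ds (\<delta> * t) + p * prob_le ds (\<delta> * t - d) \<le>
      (1 - p) * prob_le (map (rescaled \<delta>) ds) t + p * prob_le (map (rescaled \<delta>) ds) (t - d / \<delta>)"
      using IH[OF Cons(3)] v by (intro add_mono mult_left_mono) auto
    then show ?thesis by (simp add: a) (simp add: r[unfolded a])
  qed
qed

lemma mean_blocked: "step_list ds \<Longrightarrow> mean ds \<le> small_mean \<delta> ds + mean (map (blocked \<delta>) ds)"
proof (induction ds)
  case (Cons a ds)
  obtain d p where a: "a = (d, p)" by fastforce
  have "d * p \<le> p" using Cons(2) by (auto simp: a mult_left_le_one_le)
  then show ?case using Cons by (auto simp: a small_mean_def blocked_def)
qed (simp add: small_mean_def)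

lemma mean_rescaled: "mean (map (rescaled \<delta>) ds) = small_mean \<delta> ds / \<delta> + mean (map (blocked \<delta>) ds)"
  by (induction ds) (auto simp: small_mean_def blocked_def rescaled_def add_divide_distrib)

text \<open>A triple \<open>(a, b, p)\<close> stands for a variable with values \<open>a\<close> and \<open>b\<close>, where \<open>b\<close> has probability \<open>p\<close>. Let \<open>\<delta>\<close> be the
room left by the lower values. If the jumps that fit into \<open>\<delta>\<close> have total mean at most \<open>\<delta>\<close>,
then removing them and pinning one of these summands at \<open>1\<close> does not lower the mean. If their
total mean is larger than \<open>\<delta>\<close>, then stretching the room to \<open>1\<close> does not lower the mean. If no jump
fits, the summand with the least \<open>p\<close> is pinned.\<close>
lemma two_point_bound:
  fixes ts :: "(real \<times> real \<times> real) list"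
  assumes ts: "\<forall>(a, b, p) \<in> set ts. 0 \<le> a \<and> a \<le> b \<and> b \<le> 1 \<and> 0 \<le> p \<and> p \<le> 1" and ne: "ts \<noteq> []"
  shows "prob_le (map (\<lambda>(a, b, p). (b - a, p)) ts) (1 - (\<Sum>(a, b, p)\<leftarrow>ts. a))
     \<le> extremal_bound (length ts) 0 (\<Sum>(a, b, p)\<leftarrow>ts. (1 - p) * a + p * b)"
proof -
  define ds where "ds = map (\<lambda>(a, b, p). (b - a, p)) ts"
  define A where "A = (\<Sum>(a, b, p)\<leftarrow>ts. a)"
  define lam where "lam = (\<Sum>(a, b, p)\<leftarrow>ts. (1 - p) * a + p * b)"
  define n where "n = length ts"
  have n1: "n \<ge> 1" using ne by (simp add: n_def Suc_le_eq)
  have ds: "step_list ds" using ts by (force simp: ds_def)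
  have len: "length ds = n" by (simp add: ds_def n_def)
  have A0: "A \<ge> 0" unfolding A_def using ts by (intro sum_list_nonneg) auto
  have mean_ds: "lam = A + mean ds"
    unfolding lam_def A_def ds_def by (induction ts) (auto simp: algebra_simps)
  have lam: "0 \<le> lam" "lam \<le> n"
  proof -
    show "0 \<le> lam" unfolding lam_def using ts by (intro sum_list_nonneg) (auto intro!: add_nonneg_nonneg mult_nonneg_nonneg)
    show "lam \<le> n" unfolding lam_def n_def using ts
    proof (induction ts)
      case (Cons t ts)
      obtain a b p where t: "t = (a, b, p)" by (metis prod_cases3)
      have "(1 - p) * a + p * b \<le> (1 - p) * 1 + p * 1"
        using Cons(2) by (intro add_mono mult_left_mono) (auto simp: t)
      then show ?case using Cons by (auto simp: t)
    qed simp
  qed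
  have mB: "mean ds \<le> small_mean \<delta> ds + mean (map (blocked \<delta>) ds)" for \<delta> by (rule mean_blocked[OF ds])
  define \<delta> where "\<delta> = 1 - A"
  \<comment> \<open>pinning the summand \<open>x\<close> at \<open>1\<close> leaves room for no further jump\<close>
  have one_fixed: ?thesis if u: "ds = us @ x # vs" and bx: "prob_le ds \<delta> \<le> all_zero (map (blocked \<delta>) (us @ vs))"
     and m: "lam \<le> 1 + mean (map (blocked \<delta>) (us @ vs))" for us x vs
  proof -
    let ?zs = "map (blocked \<delta>) (us @ vs)"
    have s: "step_list (us @ vs)" using ds by (auto simp: u)
    have vz: "jump_list ?zs" by (rule jump_list_blocked[OF s])
    have "prob_le ((1, 1) # ?zs) 1 = all_zero ?zs" using prob_le_zero[OF vz] by (simp del: map_append)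
    then have "prob_le ds \<delta> \<le> prob_le ((1, 1) # ?zs) 1" using bx by simp
    also have "\<dots> \<le> extremal_bound (length ((1, 1) # ?zs)) 0 lam"
      using vz lam m by (intro prob_le_extremal_bound) (simp_all del: map_append)
    also have "length ((1, 1) # ?zs) = n" using len by (simp add: u)
    finally show ?thesis by (simp add: ds_def lam_def n_def \<delta>_def A_def)
  qed
  consider "\<delta> < 0" | "\<delta> \<ge> 0" "\<forall>(d, p) \<in> set ds. d > \<delta>"
    | "\<delta> \<ge> 0" "\<not> (\<forall>(d, p) \<in> set ds. d > \<delta>)" "small_mean \<delta> ds \<le> \<delta>" | "\<delta> \<ge> 0" "small_mean \<delta> ds > \<delta>" by linarith
  then show ?thesis
  proof cases
    case 1
    then have "prob_le ds \<delta> = 0" by (intro prob_le_neg_step_list[OF ds])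
    moreover have "0 \<le> extremal_bound n 0 lam" using n1 lam by (intro extremal_bound_nonneg) auto
    ultimately show ?thesis by (simp add: ds_def lam_def n_def \<delta>_def A_def)
  next
    case 2
    define p0 where "p0 = Min ((\<lambda>(a, b, p). p) ` set ts)"
    have "p0 \<in> (\<lambda>(a, b, p). p) ` set ts" unfolding p0_def using ne by (intro Min_in) auto
    then obtain a0 b0 where t0: "(a0, b0, p0) \<in> set ts" by auto
    have p0: "p0 \<le> p" if "(a, b, p) \<in> set ts" for a b p
      unfolding p0_def using that by (intro Min_le) force+
    from t0 obtain tu tv where tt: "ts = tu @ (a0, b0, p0) # tv" by (metis split_list)
    let ?f = "\<lambda>(a::real, b::real, p::real). (b - a, p)"
    have u: "ds = map ?f tu @ ?f (a0, b0, p0) # map ?f tv" by (simp add: ds_def tt)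
    have blk: "map (blocked \<delta>) ds = map (\<lambda>(d, p). (1, p)) ds"
      using 2 by (auto simp: blocked_def)
    have p01: "0 \<le> p0" "p0 \<le> 1" using t0 ts by auto
    show ?thesis
    proof (rule one_fixed[OF u])
      let ?r = "map (blocked \<delta>) (map ?f tu @ map ?f tv)"
      have d0: "b0 - a0 > \<delta>" using 2 by (auto simp: u)
      have s: "step_list (map ?f tu @ map ?f tv)" using ds by (auto simp: u)
      have az: "all_zero (map (blocked \<delta>) ds) = (1 - p0) * all_zero ?r"
        using d0 by (simp add: u blocked_def)
      have "prob_le ds \<delta> \<le> (1 - p0) * all_zero ?r"
        using prob_le_blocked[OF ds order_refl, of \<delta>] az by simp
      also have "\<dots> \<le> all_zero ?r"
        using all_zero_bounds[OF jump_list_blocked[OF s, of \<delta>]] p01 by (simp add: mult_left_le_one_le)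
      finally show "prob_le ds \<delta> \<le> all_zero ?r" .
      have mr: "mean (map (blocked \<delta>) ds) = p0 + mean ?r" using d0 by (simp add: u blocked_def)
      \<comment> \<open>raising \<open>A\<close> to \<open>1\<close> in the summand with the least \<open>p\<close> does not lower the mean\<close>
      have "mean ds + p0 * A \<le> (\<Sum>(a, b, p)\<leftarrow>ts. p)"
        unfolding ds_def A_def using ts p0
      proof (induction ts)
        case (Cons t ts)
        obtain a b p where t: "t = (a, b, p)" by (metis prod_cases3)
        have "(b - a) * p + p0 * a \<le> p"
        proof -
          have "(b - a) * p \<le> (1 - a) * p" using Cons(2) by (intro mult_right_mono) (auto simp: t)
          moreover have "p0 * a \<le> p * a" using Cons(2,3) by (intro mult_right_mono) (auto simp: t)
          ultimately show ?thesis by (simp add: algebra_simps)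
        qed
        moreover have "mean (map ?f ts) + p0 * (\<Sum>(a, b, p)\<leftarrow>ts. a) \<le> (\<Sum>(a, b, p)\<leftarrow>ts. p)"
          using Cons(2,3) by (intro Cons(1)) auto
        moreover have "mean (map ?f (t # ts)) = (b - a) * p + mean (map ?f ts)"
          "(\<Sum>(a, b, p)\<leftarrow>t # ts. a) = a + (\<Sum>(a, b, p)\<leftarrow>ts. a)"
          "(\<Sum>(a, b, p)\<leftarrow>t # ts. p) = p + (\<Sum>(a, b, p)\<leftarrow>ts. p)" by (simp_all add: t)
        ultimately show ?case by (simp only: distrib_left)
      qed simp
      also have "(\<Sum>(a, b, p)\<leftarrow>ts. p) = mean (map (\<lambda>(d, p). (1, p)) ds)"
        unfolding ds_def by (induction ts) auto
      also have "\<dots> = p0 + mean ?r" using mr blk by simp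
      finally have "lam \<le> p0 + mean ?r + A - p0 * A" by (simp add: mean_ds)
      moreover have "p0 * (1 - A) \<le> 1 - A" using p01 2 by (simp add: \<delta>_def mult_left_le_one_le)
      ultimately show "lam \<le> 1 + mean ?r" by (simp add: algebra_simps)
    qed
  next
    case 3
    then obtain d p where dp: "(d, p) \<in> set ds" "d \<le> \<delta>" by auto
    then obtain us vs where u: "ds = us @ (d, p) # vs" by (metis split_list)
    show ?thesis
    proof (rule one_fixed[OF u])
      show "prob_le ds \<delta> \<le> all_zero (map (blocked \<delta>) (us @ vs))"
        using prob_le_blocked[OF ds order_refl, of \<delta>] dp by (simp add: u blocked_def)
      have "mean (map (blocked \<delta>) ds) = mean (map (blocked \<delta>) (us @ vs))"
        using dp by (simp add: u blocked_def)
      then show "lam \<le> 1 + mean (map (blocked \<delta>) (us @ vs))"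
        using mB[of \<delta>] 3 by (simp add: mean_ds \<delta>_def)
    qed
  next
    case 4
    have dpos: "\<delta> > 0"
    proof (rule ccontr)
      assume "\<not> \<delta> > 0"
      then have "small_mean \<delta> ds \<le> 0"
        unfolding small_mean_def using ds by (intro sum_list_nonpos) (auto simp: mult_nonpos_nonneg split: if_splits)
      then show False using 4 by simp
    qed
    let ?zs = "map (rescaled \<delta>) ds"
    have "prob_le ds \<delta> \<le> prob_le ?zs 1" using prob_le_rescaled[OF ds order_refl dpos] by simp
    also have "\<dots> \<le> extremal_bound (length ?zs) 0 lam"
    proof (rule prob_le_extremal_bound)
      show "jump_list ?zs" using ds dpos by (fastforce simp: jump_list_def rescaled_def split: if_splits)
      show "?zs \<noteq> []" using ne by (simp add: ds_def)
      have "1 * (1 - \<delta>) \<le> small_mean \<delta> ds / \<delta> * (1 - \<delta>)"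
        using 4 dpos A0 by (intro mult_right_mono) (auto simp: \<delta>_def)
      also have "\<dots> = small_mean \<delta> ds / \<delta> - small_mean \<delta> ds" using dpos by (simp add: right_diff_distrib)
      finally have "1 - \<delta> + small_mean \<delta> ds \<le> small_mean \<delta> ds / \<delta>" by simp
      then show "lam \<le> mean ?zs" using mB[of \<delta>] unfolding mean_rescaled mean_ds by (simp add: \<delta>_def)
    qed (rule lam)
    also have "length ?zs = n" by (simp add: len)
    finally show ?thesis by (simp add: ds_def lam_def n_def \<delta>_def A_def)
  qed
qed

section \<open>From arbitrary laws to two-point laws\<close>

text \<open>If every two-point law with mean \<open>E X\<close> gave less than \<open>v = E (g X)\<close>, then some line through the point
\<open>(E X, v)\<close> would lie above \<open>g\<close>. The value of this line at \<open>X\<close> also has expectation \<open>v\<close>, so that \<open>g\<close> and the line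
agree almost surely at \<open>X\<close>. In particular they agree at a point on each side of the mean. The law on these two
points gives exactly \<open>v\<close>.\<close>
lemma (in prob_space) two_point_dominates:
  fixes X :: "'a \<Rightarrow> real" and g :: "real \<Rightarrow> real"
  assumes X: "random_variable borel X" "AE \<omega> in M. X \<omega> \<in> {0..1}"
    and g: "g \<in> borel_measurable borel" "\<And>x. 0 \<le> g x" "\<And>x. g x \<le> 1"
  shows "\<exists>a b p. 0 \<le> a \<and> a \<le> b \<and> b \<le> 1 \<and> 0 \<le> p \<and> p \<le> 1
     \<and> (1 - p) * a + p * b = expectation X
     \<and> expectation (\<lambda>\<omega>. g (X \<omega>)) \<le> (1 - p) * g a + p * g b"
proof (rule ccontr)
  assume neg: "\<not> ?thesis"
  define m v where "m = expectation X" and "v = expectation (\<lambda>\<omega>. g (X \<omega>))"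
  have no: "(1 - p) * g a + p * g b < v"
    if "0 \<le> a" "a \<le> b" "b \<le> 1" "0 \<le> p" "p \<le> 1" "(1 - p) * a + p * b = m" for a b p
    using neg that unfolding m_def v_def by (meson not_le)
  have intX: "integrable M X"
    by (rule integrable_const_bound[where B = 1]) (use X in auto)
  have intg: "integrable M (\<lambda>\<omega>. g (X \<omega>))"
    by (rule integrable_const_bound[where B = 1]) (use X g in \<open>auto simp: abs_le_iff intro: order_trans[OF _ g(2)]\<close>)
  have m01: "0 \<le> m" "m \<le> 1"
  proof -
    show "0 \<le> m" unfolding m_def by (rule integral_nonneg_AE) (use X in auto)
    have "m \<le> expectation (\<lambda>_. 1)" unfolding m_def by (rule integral_mono_AE) (use X intX in auto)
    then show "m \<le> 1" by (simp add: prob_space)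
  qed
  have gm: "g m < v" using no[of m m 0] m01 by simp
  define D where "D = (\<lambda>b. (g b - v) / (b - m))"
  have slopes: "D b \<le> (v - g a) / (m - a)" if "0 \<le> a" "a < m" "m < b" "b \<le> 1" for a b
  proof -
    define p where "p = (m - a) / (b - a)"
    have p: "0 \<le> p" "p \<le> 1" "1 - p = (b - m) / (b - a)" using that by (auto simp: p_def field_simps)
    have "(1 - p) * a + p * b = a + p * (b - a)" by (simp add: algebra_simps)
    also have "\<dots> = m" using that by (simp add: p_def)
    finally have "(1 - p) * g a + p * g b < v" using that p by (intro no) auto
    then have "(1 - p) * g a * (b - a) + p * g b * (b - a) < v * (b - a)"
      using that by (simp add: mult_strict_right_mono flip: distrib_right)
    moreover have "(1 - p) * g a * (b - a) = (b - m) * g a" "p * g b * (b - a) = (m - a) * g b"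
    proof -
      have "(1 - p) * (b - a) = b - m" "p * (b - a) = m - a" using that by (simp add: p(3)) (use that in \<open>simp add: p_def\<close>)
      then show "(1 - p) * g a * (b - a) = (b - m) * g a" "p * g b * (b - a) = (m - a) * g b"
        by (metis mult.assoc mult.commute)+
    qed
    ultimately have "(m - a) * (g b - v) \<le> (v - g a) * (b - m)" by (simp add: algebra_simps)
    then show ?thesis using that unfolding D_def by (simp add: divide_le_eq le_divide_eq mult.commute)
  qed
  \<comment> \<open>\<open>k\<close> is the slope of a line through \<open>(m, v)\<close> above \<open>g\<close>\<close>
  obtain k where k: "\<And>x. 0 \<le> x \<Longrightarrow> x \<le> 1 \<Longrightarrow> x \<noteq> m \<Longrightarrow> 0 < m \<Longrightarrow> m < 1 \<Longrightarrow> g x \<le> v + k * (x - m)"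
  proof -
    define k where "k = Sup (D ` {m<..1})"
    have "g x \<le> v + k * (x - m)" if x: "0 \<le> x" "x \<le> 1" "x \<noteq> m" and mm: "0 < m" "m < 1" for x
    proof (cases "x < m")
      case True
      have "k \<le> (v - g x) / (m - x)" unfolding k_def
        using True x mm slopes by (intro cSup_least) auto
      then have "k * (m - x) \<le> v - g x" using True by (simp add: le_divide_eq)
      then show ?thesis by (simp add: algebra_simps)
    next
      case False
      then have "x > m" using x by simp
      have "bdd_above (D ` {m<..1})" using slopes[of 0] mm by (intro bdd_aboveI2[where M = "(v - g 0) / m"]) auto
      then have "D x \<le> k" unfolding k_def using \<open>x > m\<close> x by (intro cSup_upper) auto
      then have "g x - v \<le> k * (x - m)" using \<open>x > m\<close> by (simp add: D_def divide_le_eq)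
      then show ?thesis by simp
    qed
    then show ?thesis using that by blast
  qed
  have AEm: "\<not> (AE \<omega> in M. X \<omega> = m)"
  proof
    assume "AE \<omega> in M. X \<omega> = m"
    then have "v = expectation (\<lambda>_. g m)" unfolding v_def
      by (intro integral_cong_AE) (use X g in auto)
    then show False using gm by (simp add: prob_space)
  qed
  \<comment> \<open>a variable that stays on one side of its mean is constant\<close>
  have side: False if "AE \<omega> in M. 0 \<le> s * (X \<omega> - m)" "s \<noteq> 0" for s
  proof -
    have "expectation (\<lambda>\<omega>. s * (X \<omega> - m)) = 0" using intX by (simp add: m_def prob_space)
    then have "AE \<omega> in M. s * (X \<omega> - m) = 0"
      using that(1) intX by (subst (asm) integral_nonneg_eq_0_iff_AE) auto
    then show False using AEm that(2) by simp
  qed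
  have m0: "0 < m"
  proof (rule ccontr)
    assume "\<not> 0 < m"
    then show False using side[of 1] X(2) m01 by (auto elim: eventually_mono)
  qed
  have m1: "m < 1"
  proof (rule ccontr)
    assume "\<not> m < 1"
    then show False using side[of "-1"] X(2) m01 by (auto elim: eventually_mono)
  qed
  have line: "g x \<le> v + k * (x - m)" if "0 \<le> x" "x \<le> 1" for x
    using k[OF that _ m0 m1] gm by (cases "x = m") auto
  have "expectation (\<lambda>\<omega>. v + k * (X \<omega> - m) - g (X \<omega>)) = 0"
    using intX intg by (simp add: m_def v_def prob_space)
  moreover have "AE \<omega> in M. 0 \<le> v + k * (X \<omega> - m) - g (X \<omega>)"
    using X(2) by eventually_elim (use line in auto)
  ultimately have tight: "AE \<omega> in M. v + k * (X \<omega> - m) - g (X \<omega>) = 0"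
    using intX intg by (subst (asm) integral_nonneg_eq_0_iff_AE) auto
  have "\<exists>a. 0 \<le> a \<and> a < m \<and> g a = v + k * (a - m)"
  proof (rule ccontr)
    assume n: "\<not> ?thesis"
    have "AE \<omega> in M. 0 \<le> 1 * (X \<omega> - m)"
      using tight X(2) by eventually_elim (use n in force)
    then show False using side[of 1] by simp
  qed
  then obtain a where a: "0 \<le> a" "a < m" "g a = v + k * (a - m)" by blast
  have "\<exists>b. m < b \<and> b \<le> 1 \<and> g b = v + k * (b - m)"
  proof (rule ccontr)
    assume n: "\<not> ?thesis"
    have "AE \<omega> in M. 0 \<le> (-1) * (X \<omega> - m)"
      using tight X(2) by eventually_elim (use n in force)
    then show False using side[of "-1"] by simp
  qed
  then obtain b where b: "m < b" "b \<le> 1" "g b = v + k * (b - m)" by blast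
  define p where "p = (m - a) / (b - a)"
  have p: "0 \<le> p" "p \<le> 1" using a b by (auto simp: p_def field_simps)
  have pm: "(1 - p) * a + p * b = m"
  proof -
    have "(1 - p) * a + p * b = a + p * (b - a)" by (simp add: algebra_simps)
    also have "\<dots> = m" using a b by (simp add: p_def)
    finally show ?thesis .
  qed
  have "(1 - p) * g a + p * g b = v + k * ((1 - p) * a + p * b - m)"
    unfolding a(3) b(3) by (simp add: algebra_simps)
  then have "(1 - p) * g a + p * g b = v" by (simp add: pm)
  then show False using no[of a b p] a b p pm by simp
qed

lemma prob_le_measurable [measurable]: "prob_le xs \<in> borel_measurable borel"
proof (induction xs)
  case Nil
  have "prob_le [] = indicator {0..}" by (auto simp: indicator_def)
  then show ?case by simp
next
  case (Cons a xs)
  obtain b p where a: "a = (b, p)" by fastforce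
  have [measurable]: "prob_le xs \<in> borel_measurable borel" by (rule Cons)
  have "prob_le (a # xs) = (\<lambda>t. (1 - p) * prob_le xs t + p * prob_le xs (t - b))" by (auto simp: a)
  also have "\<dots> \<in> borel_measurable borel" by measurable
  finally show ?case .
qed

text \<open>By independence, the expectation is \<open>E (g X)\<close> with \<open>g x = E (\<phi> (x + Y))\<close>.\<close>
lemma (in prob_space) replace_summand:
  fixes X Y :: "'a \<Rightarrow> real" and \<phi> :: "real \<Rightarrow> real"
  assumes ind: "indep_var borel X borel Y" and X: "AE \<omega> in M. X \<omega> \<in> {0..1}"
    and \<phi> [measurable]: "\<phi> \<in> borel_measurable borel" and \<phi>_bounds: "\<And>x. 0 \<le> \<phi> x" "\<And>x. \<phi> x \<le> 1"
  shows "\<exists>a b p. 0 \<le> a \<and> a \<le> b \<and> b \<le> 1 \<and> 0 \<le> p \<and> p \<le> 1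
     \<and> (1 - p) * a + p * b = expectation X
     \<and> expectation (\<lambda>\<omega>. \<phi> (X \<omega> + Y \<omega>)) \<le> expectation (\<lambda>\<omega>. (1 - p) * \<phi> (a + Y \<omega>) + p * \<phi> (b + Y \<omega>))"
proof -
  have rv [measurable]: "random_variable borel X" "random_variable borel Y"
    using ind by (auto dest: indep_var_rv1 indep_var_rv2)
  let ?X = "distr M borel X" and ?Y = "distr M borel Y"
  interpret X: prob_space ?X by (rule prob_space_distr) fact
  interpret Y: prob_space ?Y by (rule prob_space_distr) fact
  interpret XY: pair_prob_space ?X ?Y ..
  define g where "g = (\<lambda>x. \<integral>y. \<phi> (x + y) \<partial>?Y)"
  have g_eq: "g x = expectation (\<lambda>\<omega>. \<phi> (x + Y \<omega>))" for x
    unfolding g_def by (subst integral_distr) auto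
  have g_meas [measurable]: "g \<in> borel_measurable borel"
    unfolding g_def by (rule Y.borel_measurable_lebesgue_integral) measurable
  have int: "integrable M (\<lambda>\<omega>. \<phi> (x + Y \<omega>))" for x
    by (rule integrable_const_bound[where B = 1]) (use \<phi>_bounds in auto)
  have g01: "0 \<le> g x" "g x \<le> 1" for x
  proof -
    show "0 \<le> g x" unfolding g_eq using \<phi>_bounds by (intro integral_nonneg_AE) auto
    have "g x \<le> expectation (\<lambda>_. 1)" unfolding g_eq using \<phi>_bounds by (intro integral_mono int) auto
    then show "g x \<le> 1" by (simp add: prob_space)
  qed
  have "expectation (\<lambda>\<omega>. \<phi> (X \<omega> + Y \<omega>)) = (\<integral>z. \<phi> (fst z + snd z) \<partial>distr M (borel \<Otimes>\<^sub>M borel) (\<lambda>\<omega>. (X \<omega>, Y \<omega>)))"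
    by (subst integral_distr) auto
  also have "distr M (borel \<Otimes>\<^sub>M borel) (\<lambda>\<omega>. (X \<omega>, Y \<omega>)) = ?X \<Otimes>\<^sub>M ?Y"
    using ind by (simp add: indep_var_distribution_eq)
  also have "(\<integral>z. \<phi> (fst z + snd z) \<partial>(?X \<Otimes>\<^sub>M ?Y)) = (\<integral>x. g x \<partial>?X)"
    unfolding g_def
    by (subst XY.integral_fst'[symmetric])
       (auto intro!: XY.P.integrable_const_bound[where B = 1] simp: \<phi>_bounds)
  also have "\<dots> = expectation (\<lambda>\<omega>. g (X \<omega>))" by (subst integral_distr) auto
  finally have E: "expectation (\<lambda>\<omega>. \<phi> (X \<omega> + Y \<omega>)) = expectation (\<lambda>\<omega>. g (X \<omega>))" .
  obtain a b p where abp: "0 \<le> a" "a \<le> b" "b \<le> 1" "0 \<le> p" "p \<le> 1" "(1 - p) * a + p * b = expectation X"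
    "expectation (\<lambda>\<omega>. g (X \<omega>)) \<le> (1 - p) * g a + p * g b"
    using two_point_dominates[OF rv(1) X g_meas g01] by blast
  have "(1 - p) * g a + p * g b = expectation (\<lambda>\<omega>. (1 - p) * \<phi> (a + Y \<omega>) + p * \<phi> (b + Y \<omega>))"
    unfolding g_eq using int by simp
  with abp E show ?thesis by (intro exI[of _ a] exI[of _ b] exI[of _ p]) auto
qed

text \<open>The last \<open>k\<close> variables have been replaced. Their joint contribution given the first \<open>n - k\<close> variables
is a value of \<open>prob_le\<close>, which serves as the function \<open>\<phi>\<close> for the next replacement.\<close>
lemma (in prob_space) reduction_to_two_points:
  fixes X :: "nat \<Rightarrow> 'a \<Rightarrow> real"
  assumes ind: "indep_vars (\<lambda>_. borel) X {1..n}"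
    and X: "\<And>i. i \<in> {1..n} \<Longrightarrow> AE \<omega> in M. X i \<omega> \<in> {0..1}"
    and k: "k \<le> n"
  shows "\<exists>ts :: (real \<times> real \<times> real) list. length ts = k
     \<and> (\<forall>(a, b, p) \<in> set ts. 0 \<le> a \<and> a \<le> b \<and> b \<le> 1 \<and> 0 \<le> p \<and> p \<le> 1)
     \<and> (\<Sum>(a, b, p)\<leftarrow>ts. (1 - p) * a + p * b) = (\<Sum>i\<in>{n-k<..n}. expectation (X i))
     \<and> prob {\<omega> \<in> space M. (\<Sum>i=1..n. X i \<omega>) \<le> 1}
        \<le> expectation (\<lambda>\<omega>. prob_le (map (\<lambda>(a, b, p). (b - a, p)) ts)
             (1 - (\<Sum>(a, b, p)\<leftarrow>ts. a) - (\<Sum>i=1..n-k. X i \<omega>)))"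
  using k
proof (induction k)
  case 0
  have rv: "random_variable borel (X i)" if "i \<in> {1..n}" for i
    using ind that by (auto simp: indep_vars_def)
  have [measurable]: "(\<lambda>\<omega>. \<Sum>i=1..n. X i \<omega>) \<in> borel_measurable M"
    using rv by (intro borel_measurable_sum) auto
  have "expectation (\<lambda>\<omega>. prob_le [] (1 - (\<Sum>i=1..n. X i \<omega>)))
     = expectation (indicator {\<omega> \<in> space M. (\<Sum>i=1..n. X i \<omega>) \<le> 1})"
    by (intro Bochner_Integration.integral_cong) (auto simp: indicator_def)
  also have "\<dots> = prob ({\<omega> \<in> space M. (\<Sum>i=1..n. X i \<omega>) \<le> 1} \<inter> space M)" by simp
  also have "{\<omega> \<in> space M. (\<Sum>i=1..n. X i \<omega>) \<le> 1} \<inter> space M = {\<omega> \<in> space M. (\<Sum>i=1..n. X i \<omega>) \<le> 1}" by auto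
  finally show ?case by (intro exI[of _ "[]"]) simp
next
  case (Suc k)
  then have "k \<le> n" by simp
  from Suc.IH[OF this] obtain ts :: "(real \<times> real \<times> real) list" where ts: "length ts = k"
     "\<forall>(a, b, p) \<in> set ts. 0 \<le> a \<and> a \<le> b \<and> b \<le> 1 \<and> 0 \<le> p \<and> p \<le> 1"
     "(\<Sum>(a, b, p)\<leftarrow>ts. (1 - p) * a + p * b) = (\<Sum>i\<in>{n-k<..n}. expectation (X i))"
     "prob {\<omega> \<in> space M. (\<Sum>i=1..n. X i \<omega>) \<le> 1}
        \<le> expectation (\<lambda>\<omega>. prob_le (map (\<lambda>(a, b, p). (b - a, p)) ts)
             (1 - (\<Sum>(a, b, p)\<leftarrow>ts. a) - (\<Sum>i=1..n-k. X i \<omega>)))" by blast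
  define j where "j = n - Suc k"
  have nk: "n - k = Suc j" using Suc.prems by (simp add: j_def)
  have jn: "Suc j \<le> n" using Suc.prems by (simp add: j_def)
  define ds A where "ds = map (\<lambda>(a, b, p). (b - a, p)) ts" and "A = (\<Sum>(a, b, p)\<leftarrow>ts. a)"
  define \<phi> where "\<phi> = (\<lambda>s. prob_le ds (1 - A - s))"
  have pr: "\<forall>(d, p) \<in> set ds. 0 \<le> p \<and> p \<le> 1" using ts(2) by (force simp: ds_def)
  have \<phi>: "\<phi> \<in> borel_measurable borel" unfolding \<phi>_def by measurable
  have \<phi>01: "0 \<le> \<phi> x" "\<phi> x \<le> 1" for x unfolding \<phi>_def using prob_le_bounds[OF pr] by blast+
  have "indep_vars (\<lambda>_. borel) X (insert (Suc j) {1..j})"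
    by (rule indep_vars_subset[OF ind]) (use jn in auto)
  then have iv: "indep_var borel (X (Suc j)) borel (\<lambda>\<omega>. \<Sum>i\<in>{1..j}. X i \<omega>)"
    by (rule indep_vars_sum[rotated 2]) auto
  have sumS: "(\<Sum>i=1..n-k. X i \<omega>) = X (Suc j) \<omega> + (\<Sum>i\<in>{1..j}. X i \<omega>)" for \<omega>
    by (simp add: nk)
  obtain a b p where abp: "0 \<le> a" "a \<le> b" "b \<le> 1" "0 \<le> p" "p \<le> 1" "(1 - p) * a + p * b = expectation (X (Suc j))"
    and le: "expectation (\<lambda>\<omega>. \<phi> (X (Suc j) \<omega> + (\<Sum>i\<in>{1..j}. X i \<omega>)))
      \<le> expectation (\<lambda>\<omega>. (1 - p) * \<phi> (a + (\<Sum>i\<in>{1..j}. X i \<omega>)) + p * \<phi> (b + (\<Sum>i\<in>{1..j}. X i \<omega>)))"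
    using replace_summand[OF iv X[of "Suc j"] \<phi> \<phi>01] jn by auto
  show ?case
  proof (intro exI[of _ "(a, b, p) # ts"] conjI)
    show "length ((a, b, p) # ts) = Suc k" using ts by simp
    show "\<forall>(a, b, p) \<in> set ((a, b, p) # ts). 0 \<le> a \<and> a \<le> b \<and> b \<le> 1 \<and> 0 \<le> p \<and> p \<le> 1"
      using ts(2) abp by simp
    have "{n - Suc k<..n} = insert (Suc j) {n - k<..n}" using Suc.prems nk by (auto simp: j_def)
    moreover have "Suc j \<notin> {n - k<..n}" by (simp add: nk)
    ultimately show "(\<Sum>(a, b, p)\<leftarrow>(a, b, p) # ts. (1 - p) * a + p * b) = (\<Sum>i\<in>{n - Suc k<..n}. expectation (X i))"
      using ts(3) abp(6) by simp
    have "prob {\<omega> \<in> space M. (\<Sum>i=1..n. X i \<omega>) \<le> 1}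
       \<le> expectation (\<lambda>\<omega>. \<phi> (X (Suc j) \<omega> + (\<Sum>i\<in>{1..j}. X i \<omega>)))"
      using ts(4) unfolding sumS ds_def[symmetric] A_def[symmetric] by (simp add: \<phi>_def)
    also note le
    also have "(\<lambda>\<omega>. (1 - p) * \<phi> (a + (\<Sum>i\<in>{1..j}. X i \<omega>)) + p * \<phi> (b + (\<Sum>i\<in>{1..j}. X i \<omega>)))
      = (\<lambda>\<omega>. prob_le (map (\<lambda>(a, b, p). (b - a, p)) ((a, b, p) # ts))
             (1 - (\<Sum>(a, b, p)\<leftarrow>(a, b, p) # ts. a) - (\<Sum>i=1..n - Suc k. X i \<omega>)))"
      by (simp add: \<phi>_def ds_def A_def j_def algebra_simps)
    finally show "prob {\<omega> \<in> space M. (\<Sum>i=1..n. X i \<omega>) \<le> 1}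
       \<le> expectation (\<lambda>\<omega>. prob_le (map (\<lambda>(a, b, p). (b - a, p)) ((a, b, p) # ts))
             (1 - (\<Sum>(a, b, p)\<leftarrow>(a, b, p) # ts. a) - (\<Sum>i=1..n - Suc k. X i \<omega>)))" .
  qed
qed

section \<open>The theorem\<close>

lemma extremal_bound_zero_max:
  assumes "n \<ge> 1" "lam \<le> real n"
  shows "extremal_bound n 0 lam = max ((1 + lam - lam / real n) * (1 - lam / real n) ^ (n - 1))
                 ((1 - (lam - 1) / (real n - 1)) ^ (n - 1))"
proof -
  have "(1 - lam / n) ^ (n - 1) * pinning_factor n = (1 - (lam - 1) / (real n - 1)) ^ (n - 1)"
  proof (cases "n = 1")
    case False
    then have n2: "n \<ge> 2" using assms by simp
    have "1 - (lam - 1) / (real n - 1) = (real n - lam) / (real n - 1)" using n2 by (simp add: field_simps)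
    then show ?thesis using pinned_form[OF n2, of lam] by simp
  qed simp
  then show ?thesis using assms by (simp add: extremal_bound_eq max.commute mult.commute algebra_simps)
qed

theorem theorem1:
  fixes M :: "'a measure" and X :: "nat \<Rightarrow> 'a \<Rightarrow> real" and S :: "'a \<Rightarrow> real"
    and n :: nat and lam :: real
  assumes "prob_space M"
    and "n \<ge> 1"
    and "prob_space.indep_vars M (\<lambda>_. borel) X {1..n}"
    and "\<And>i. i \<in> {1..n} \<Longrightarrow> \<P>(\<omega> in M. 0 \<le> X i \<omega> \<and> X i \<omega> \<le> 1) = 1"
    and "S = (\<lambda>\<omega>. \<Sum>i=1..n. X i \<omega>)"
    and "prob_space.expectation M S = lam"
  shows "\<P>(\<omega> in M. S \<omega> \<le> 1)
           \<le> max ((1 + lam - lam / real n) * (1 - lam / real n) ^ (n - 1))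
                 ((1 - (lam - 1) / (real n - 1)) ^ (n - 1))
       \<and> max ((1 + lam - lam / real n) * (1 - lam / real n) ^ (n - 1))
             ((1 - (lam - 1) / (real n - 1)) ^ (n - 1))
           \<le> max (1 + lam) (exp 1) * exp (- lam)"
proof -
  interpret prob_space M by fact
  have rv [measurable]: "random_variable borel (X i)" if "i \<in> {1..n}" for i
    using assms(3) that by (auto simp: indep_vars_def)
  have AEX: "AE \<omega> in M. X i \<omega> \<in> {0..1}" if i: "i \<in> {1..n}" for i
  proof -
    have [measurable]: "random_variable borel (X i)" using i by (rule rv)
    have "{\<omega> \<in> space M. 0 \<le> X i \<omega> \<and> X i \<omega> \<le> 1} \<in> events" by measurable
    with assms(4)[OF i] have "AE \<omega> in M. 0 \<le> X i \<omega> \<and> X i \<omega> \<le> 1"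
      by (subst prob_Collect_eq_1[symmetric]) auto
    then show ?thesis by simp
  qed
  have intX: "integrable M (X i)" if "i \<in> {1..n}" for i
    by (rule integrable_const_bound[where B = 1]) (use AEX[OF that] rv[OF that] in auto)
  have lam: "lam = (\<Sum>i=1..n. expectation (X i))"
    unfolding assms(6)[symmetric] assms(5) using intX by (subst Bochner_Integration.integral_sum) auto
  have EX: "0 \<le> expectation (X i) \<and> expectation (X i) \<le> 1" if "i \<in> {1..n}" for i
  proof
    show "0 \<le> expectation (X i)" by (rule integral_nonneg_AE) (use AEX[OF that] in auto)
    have "expectation (X i) \<le> expectation (\<lambda>_. 1)" by (rule integral_mono_AE) (use AEX[OF that] intX[OF that] in auto)
    then show "expectation (X i) \<le> 1" by (simp add: prob_space)
  qed
  have lam_bounds: "0 \<le> lam" "lam \<le> real n"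
  proof -
    show "0 \<le> lam" unfolding lam using EX by (intro sum_nonneg) auto
    show "lam \<le> real n" unfolding lam using sum_bounded_above[of "{1..n}" "\<lambda>i. expectation (X i)" 1] EX by auto
  qed
  obtain ts :: "(real \<times> real \<times> real) list" where ts: "length ts = n"
     "\<forall>(a, b, p) \<in> set ts. 0 \<le> a \<and> a \<le> b \<and> b \<le> 1 \<and> 0 \<le> p \<and> p \<le> 1"
     "(\<Sum>(a, b, p)\<leftarrow>ts. (1 - p) * a + p * b) = (\<Sum>i\<in>{n-n<..n}. expectation (X i))"
     "prob {\<omega> \<in> space M. (\<Sum>i=1..n. X i \<omega>) \<le> 1}
        \<le> expectation (\<lambda>\<omega>. prob_le (map (\<lambda>(a, b, p). (b - a, p)) ts)
             (1 - (\<Sum>(a, b, p)\<leftarrow>ts. a) - (\<Sum>i=1..n-n. X i \<omega>)))"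
    using reduction_to_two_points[OF assms(3) AEX order_refl] by blast
  have "{n-n<..n} = {1..n}" by auto
  then have mean_ts: "(\<Sum>(a, b, p)\<leftarrow>ts. (1 - p) * a + p * b) = lam" using ts(3) by (simp add: lam)
  have "prob {\<omega> \<in> space M. S \<omega> \<le> 1} \<le> prob_le (map (\<lambda>(a, b, p). (b - a, p)) ts) (1 - (\<Sum>(a, b, p)\<leftarrow>ts. a))"
    using ts(4) by (simp add: assms(5) prob_space)
  also have "\<dots> \<le> extremal_bound n 0 lam"
  proof -
    have "ts \<noteq> []" using ts(1) assms(2) by auto
    from two_point_bound[OF ts(2) this] show ?thesis unfolding mean_ts ts(1) .
  qed
  finally have "prob {\<omega> \<in> space M. S \<omega> \<le> 1} \<le> extremal_bound n 0 lam" .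
  moreover have "extremal_bound n 0 lam \<le> max (1 + lam) (exp 1) * exp (- lam)"
    by (rule extremal_bound_le_poisson) (use assms lam_bounds in auto)
  ultimately show ?thesis using extremal_bound_zero_max[OF assms(2) lam_bounds(2)] by simp
qed

end
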